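(* In the setting described in the context (Snake model with $\beta=1$, sub-Gaussian noise, kernel $K$ satisfying the kernel assumption, nearest neighbor estimator $\hat f$), the following hold. (i) Let $\delta\ge0$, potentially changing with $n$, and let $\mathcal X:=\mathrm B^d(u^\star([0,T]),\delta)$. Assume $T\preccurlyeq(n/\log n)^{\frac{d-1}{4+d}}$ and $\delta\preccurlyeq(n/\log n)^{-\frac1{4+d}}$. Then $$\mathbf E\Big[\sup_{x\in\mathcal X}\|\hat f(x)-f^\star(x)\|_2^2\Big]\preccurlyeq\Big(\frac{n}{\log n}\Big)^{-\frac{2}{4+d}}.$$ (ii) Let $\delta:=\sup_{x\in[0,1]^d}\inf_{t\in[0,T]}\|u^\star(t)-x\|_2$. Assume $T\preccurlyeq(n/\log n)^{\frac{d-1}{4+d}}$ and $\delta\preccurlyeq(n/\log n)^{-\frac1{4+d}}$. Then $$\mathbf E\Big[\sup_{x\in[0,1]^d}\|\hat f(x)-f^\star(x)\|_2^2\Big]\preccurlyeq\Big(\frac{n}{\log n}\Big)^{-\frac{2}{4+d}}.$$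
   Context: Asymptotic notation (as $n\to\infty$): $a_n\preccurlyeq b_n$ means $\limsup_{n\to\infty} a_n/b_n<\infty$; $a_n\asymp b_n$ means $a_n\preccurlyeq b_n$ and $b_n\preccurlyeq a_n$. The quantities $d,L_0,L_1,\sigma,K$ are fixed; all other quantities may vary with $n$. Flow: for Lipschitz $f\colon\mathbb R^d\to\mathbb R^d$, $U(f,x,\cdot)$ is the unique solution $u$ of $\dot u(t)=f(u(t))$, $u(0)=x$. For $\mathcal Z\subseteq\mathbb R^d$ and $r\ge0$, $\mathrm B^d(\mathcal Z,r)$ is the union of the closed Euclidean balls of radius $r$ centered at the points of $\mathcal Z$. Model: $d\ge2$ integer, $L_0,L_1>0$; $\mathcal F$ is the set of continuously differentiable $f\colon\mathbb R^d\to\mathbb R^d$ with $\sup_x\|f(x)\|_2\le L_0$, $\sup_x\|Df(x)\|_{\mathsf{op}}\le L_1$ (operator norm with respect to the Euclidean norm); $f^\star\in\mathcal F$; $x_1\in\mathbb R^d$; $n\in\mathbb N$; $\Delta t>0$; $t_i:=i\Delta t$; $T:=n\Delta t$; $u^\star:=U(f^\star,x_1,\cdot)$. Let $\sigma\ge0$ and let $\varepsilon_1,\dots,\varepsilon_n$ be independent $\mathbb R^d$-valued with $\mathbf E[\varepsilon_i]=0$, $\mathbf E[\|\varepsilon_i\|_2^2]\le\sigma^2$. Observe $Y_i:=u^\star(t_i)+\varepsilon_i$, $i=1,\dots,n$; $x_1$ and $\Delta t$ are known, $f^\star$ is unknown. Sub-Gaussian assumption: each component $Z$ of each $\varepsilon_i$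 satisfies $\mathbf P(|Z-\mathbf E Z|\ge t)\le2\exp(-t^2/(2\sigma^2))$ for all $t>0$. Kernel assumption: $K\colon[0,\infty)\to\mathbb R$ is Lipschitz continuous, nonnegative, not identically zero, and there is $C_{\mathsf{ker}}>0$ with $K(z)\le C_{\mathsf{ker}}\mathbf 1_{[0,1]}(z)$ for all $z\ge0$. Estimator: for $t\in[0,T]$ and bandwidth $h>0$ let $(\hat\theta_0(t),\hat\theta_1(t))\in\arg\min_{\theta_0,\theta_1\in\mathbb R^d}\sum_{i=1}^n\|Y_i-\theta_0-\theta_1\frac{t_i-t}{h}\|_2^2\,K(|t_i-t|/h)$ (componentwise local linear regression). Set $\hat u(t):=\hat\theta_0(t)$ and $\hat{\dot u}(t):=h^{-1}\hat\theta_1(t)$, estimators of $u^\star$ and $\dot u^\star$. The bandwidth is chosen of the optimal order for the sup-norm error, $h\asymp(T\log(n)/n)^{1/5}$, with suitable implied constants. For continuous $u\colon[0,T]\to\mathbb R^d$ let $t_{\mathsf{NN}}(u,T,x)\in\arg\min_{t\in[0,T]}\|u(t)-x\|_2$ (arbitrary choice if not unique). Define $\hat f(x):=\hat{\dot u}(t_{\mathsf{NN}}(\hat u,T,x))$.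
   Formalization: Part (i) is proved under the additional condition that 2h ≤ T for all large n (the smoothing window fits into the observation interval); without it the claim fails, e.g. for f* = 0, T = 1/n, δ = 0 with Gaussian noise. *)

theory Defs
  imports "HOL-Probability.Probability"
begin

(* a_n/b_n is formed in ennreal, so a sequence that is infinite infinitely often is not
   asymptotically dominated by a finite one.  Real sequences enter through the embedding
   ennreal; all of them are nonnegative. *)
definition asymp_le :: "(nat \<Rightarrow> ennreal) \<Rightarrow> (nat \<Rightarrow> ennreal) \<Rightarrow> bool" where
  "asymp_le a b \<longleftrightarrow> limsup (\<lambda>n. a n / b n) < \<infinity>"

definition asymp_eq :: "(nat \<Rightarrow> ennreal) \<Rightarrow> (nat \<Rightarrow> ennreal) \<Rightarrow> bool" where
  "asymp_eq a b \<longleftrightarrow> asymp_le a b \<and> asymp_le b a"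

definition log_rate :: "real \<Rightarrow> nat \<Rightarrow> ennreal" where
  "log_rate p n = ennreal ((real n / ln (real n)) powr p)"

(* The supremum of the estimation error need not be measurable, because minimizers are chosen
   arbitrarily where they are not unique.  The outer expectation equals the expectation for
   measurable X and dominates every other sensible value otherwise, so that upper bounds on it
   are the strongest form of a risk bound.  (nn_integral alone would be a lower integral.) *)
definition outer_expectation :: "'w measure \<Rightarrow> ('w \<Rightarrow> ennreal) \<Rightarrow> ennreal" where
  "outer_expectation M X =
     (INF g \<in> {g \<in> borel_measurable M. \<forall>\<omega>\<in>space M. X \<omega> \<le> g \<omega>}. \<integral>\<^sup>+\<omega>. g \<omega> \<partial>M)"

(* The norm on real ^ 'd is the Euclidean one, the norm on bounded linear maps is the
   operator norm, and continuity of Df refers to the latter. *)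
definition C1_class :: "real \<Rightarrow> real \<Rightarrow> (real ^ 'd \<Rightarrow> real ^ 'd) set" where
  "C1_class L\<^sub>0 L\<^sub>1 = {f. (\<forall>x. norm (f x) \<le> L\<^sub>0) \<and>
     (\<exists>Df :: real ^ 'd \<Rightarrow> ((real ^ 'd) \<Rightarrow>\<^sub>L (real ^ 'd)).
        (\<forall>x. (f has_derivative blinfun_apply (Df x)) (at x)) \<and>
        continuous_on UNIV Df \<and> (\<forall>x. norm (Df x) \<le> L\<^sub>1))}"

(* For Lipschitz f the solution exists on the whole real line and is unique, hence u is
   determined by f and x. *)
definition is_flow_line ::
    "(real ^ 'd \<Rightarrow> real ^ 'd) \<Rightarrow> real ^ 'd \<Rightarrow> (real \<Rightarrow> real ^ 'd) \<Rightarrow> bool" where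
  "is_flow_line f x u \<longleftrightarrow>
     u 0 = x \<and> (\<forall>t. (u has_vector_derivative f (u t)) (at t))"

definition ball_union :: "(real ^ 'd) set \<Rightarrow> real \<Rightarrow> (real ^ 'd) set" where
  "ball_union Z r = (\<Union>z\<in>Z. cball z r)"

definition unit_cube :: "(real ^ 'd) set" where
  "unit_cube = {x. \<forall>k. 0 \<le> x $ k \<and> x $ k \<le> 1}"

definition noise_model :: "real \<Rightarrow> nat \<Rightarrow> 'w measure \<Rightarrow> (nat \<Rightarrow> 'w \<Rightarrow> real ^ 'd) \<Rightarrow> bool" where
  "noise_model \<sigma> n M \<epsilon> \<longleftrightarrow>
     prob_space M \<and>
     prob_space.indep_vars M (\<lambda>_. borel) \<epsilon> {1..n} \<and>
     (\<forall>i\<in>{1..n}. integrable M (\<epsilon> i) \<and> (\<integral>\<omega>. \<epsilon> i \<omega> \<partial>M) = 0 \<and>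
        (\<integral>\<^sup>+\<omega>. ennreal ((norm (\<epsilon> i \<omega>))\<^sup>2) \<partial>M) \<le> ennreal (\<sigma>\<^sup>2))"

(* For \<sigma> = 0 the bound reads 2 here (division by zero) and is void; then the second
   moment bound already makes the noise vanish almost surely. *)
definition sub_gaussian_noise ::
    "real \<Rightarrow> nat \<Rightarrow> 'w measure \<Rightarrow> (nat \<Rightarrow> 'w \<Rightarrow> real ^ 'd) \<Rightarrow> bool" where
  "sub_gaussian_noise \<sigma> n M \<epsilon> \<longleftrightarrow>
     (\<forall>i\<in>{1..n}. \<forall>k. \<forall>t>0.
        measure M {\<omega> \<in> space M. t \<le> \<bar>\<epsilon> i \<omega> $ k - (\<integral>\<omega>'. \<epsilon> i \<omega>' $ k \<partial>M)\<bar>}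
          \<le> 2 * exp (- t\<^sup>2 / (2 * \<sigma>\<^sup>2)))"

(* Only the values of K on [0,\<infinity>) matter. *)
definition kernel_assumption :: "(real \<Rightarrow> real) \<Rightarrow> bool" where
  "kernel_assumption K \<longleftrightarrow>
     (\<exists>L. L-lipschitz_on {0..} K) \<and> (\<forall>z\<ge>0. 0 \<le> K z) \<and> (\<exists>z\<ge>0. K z \<noteq> 0) \<and>
     (\<exists>C>0. \<forall>z\<ge>0. K z \<le> C * indicator {0..1} z)"

definition local_linear_loss ::
    "(real \<Rightarrow> real) \<Rightarrow> real \<Rightarrow> nat \<Rightarrow> real \<Rightarrow> (nat \<Rightarrow> real ^ 'd) \<Rightarrow> real
      \<Rightarrow> (real ^ 'd) \<times> (real ^ 'd) \<Rightarrow> real" where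
  "local_linear_loss K h n \<Delta>t Y t = (\<lambda>(\<theta>\<^sub>0, \<theta>\<^sub>1).
     \<Sum>i=1..n. (norm (Y i - \<theta>\<^sub>0 - ((real i * \<Delta>t - t) / h) *\<^sub>R \<theta>\<^sub>1))\<^sup>2
                * K (\<bar>real i * \<Delta>t - t\<bar> / h))"

definition local_linear_fit ::
    "(real \<Rightarrow> real) \<Rightarrow> real \<Rightarrow> nat \<Rightarrow> real \<Rightarrow> (nat \<Rightarrow> real ^ 'd) \<Rightarrow> real
      \<Rightarrow> (real \<Rightarrow> real ^ 'd) \<Rightarrow> (real \<Rightarrow> real ^ 'd) \<Rightarrow> bool" where
  "local_linear_fit K h n \<Delta>t Y T \<theta>\<^sub>0 \<theta>\<^sub>1 \<longleftrightarrow>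
     (\<forall>t\<in>{0..T}. is_arg_min (local_linear_loss K h n \<Delta>t Y t) (\<lambda>_. True) (\<theta>\<^sub>0 t, \<theta>\<^sub>1 t))"

(* No condition for discontinuous u, for which a nearest time may fail to exist.  The local
   linear fit is continuous in t wherever the local least squares problems are nondegenerate. *)
definition nearest_time_selector ::
    "((real \<Rightarrow> real ^ 'd) \<Rightarrow> real \<Rightarrow> real ^ 'd \<Rightarrow> real) \<Rightarrow> bool" where
  "nearest_time_selector t\<^sub>N \<longleftrightarrow>
     (\<forall>u T x. 0 \<le> T \<and> continuous_on {0..T} u \<longrightarrow>
        is_arg_min (\<lambda>t. norm (u t - x)) (\<lambda>t. t \<in> {0..T}) (t\<^sub>N u T x))"

definition nn_estimator ::
    "((real \<Rightarrow> real ^ 'd) \<Rightarrow> real \<Rightarrow> real ^ 'd \<Rightarrow> real) \<Rightarrow> real \<Rightarrow> real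
      \<Rightarrow> (real \<Rightarrow> real ^ 'd) \<Rightarrow> (real \<Rightarrow> real ^ 'd) \<Rightarrow> real ^ 'd \<Rightarrow> real ^ 'd" where
  "nn_estimator t\<^sub>N T h \<theta>\<^sub>0 \<theta>\<^sub>1 x = (1 / h) *\<^sub>R \<theta>\<^sub>1 (t\<^sub>N \<theta>\<^sub>0 T x)"

definition sup_risk ::
    "'w measure \<Rightarrow> (real ^ 'd) set \<Rightarrow> ('w \<Rightarrow> real ^ 'd \<Rightarrow> real ^ 'd)
      \<Rightarrow> (real ^ 'd \<Rightarrow> real ^ 'd) \<Rightarrow> ennreal" where
  "sup_risk M X fh f =
     outer_expectation M (\<lambda>\<omega>. SUP x\<in>X. ennreal ((norm (fh \<omega> x - f x))\<^sup>2))"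

end

theory Submission
  imports Defs
begin

text \<open>Write \<open>N = h / \<Delta>t\<close> for the order of the number of observations in a window and
  \<open>e\<^sub>i = Y\<^sub>i - u t - (t\<^sub>i - t) *\<^sub>R f (u t)\<close> for the residuals at the true value and derivative.
  Since the local design matrix is bounded below by a constant times \<open>N\<close>, the normal equations
  bound the error of \<open>(\<theta>\<^sub>0 t, \<theta>\<^sub>1 t)\<close> by the weighted sums of the \<open>e\<^sub>i\<close> divided by \<open>N\<close>.
  Their deterministic part is \<open>O(h\<^sup>2)\<close> because \<open>u\<close> has a Lipschitz derivative; their stochastic part
  is \<open>O(sqrt (ln n / N))\<close> uniformly in \<open>t\<close>, by exponential moments and a union bound, and this is
  again \<open>O(h\<^sup>2)\<close> for the chosen bandwidth. Hence \<open>\<theta>\<^sub>0\<close> has error \<open>O(h\<^sup>2)\<close> and \<open>\<theta>\<^sub>1 / h\<close> error \<open>O(h)\<close>.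
  The curve comes \<open>\<delta>\<close>-close to \<open>x\<close>, so the point of the curve at the selected time is within
  \<open>\<delta> + O(h\<^sup>2)\<close> of \<open>x\<close>, and the Lipschitz property of \<open>f\<close> bounds the total error by \<open>O(\<delta> + h)\<close>.
  For the second claim, a curve of bounded speed that comes close to all points of the cube needs
  a time bounded below, so that again \<open>2 * h \<le> T\<close> eventually.\<close>

section \<open>Asymptotic domination\<close>

text \<open>Only d, K, \<open>L\<^sub>0\<close>, \<open>L\<^sub>1\<close> and \<sigma> are fixed;
  the vector field, the time step and even the probability space may change with n. The estimates
  are therefore proved for each single n, with constants chosen before all these objects, and limits
  enter only at the end. The bandwidth balances the two errors: as \<Delta>t = T / n, the relation
  that h^5 is of order T ln n / n says that ln n / N is of order h^4, so that sqrt (ln n / N) is of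
  order h^2. Minimizers and nearest times are arbitrary choices, which is why the risk is an outer
  expectation. It is bounded by measurable majorants that hold at every outcome and every t, not by
  probabilities of good events. The condition \<open>2 * h n \<le> T n\<close> in the first claim
  keeps the local design nondegenerate: all scaled times (t_i - t) / h lie within T / h of 0, so for
  T much smaller than h they determine a slope badly, and if K vanishes near 0 every pair can be a
  minimizer.\<close>

lemma asymp_leE:
  assumes "asymp_le a b"
  obtains C where "C > 0" "\<forall>\<^sub>F n in sequentially. a n \<le> ennreal C * b n"
proof -
  obtain c where c: "limsup (\<lambda>n. a n / b n) < c" "c < \<infinity>"
    using assms dense unfolding asymp_le_def by blast
  have "\<forall>\<^sub>F n in sequentially. a n / b n < c"
    using c(1) by (rule Limsup_lessD)
  then have "\<forall>\<^sub>F n in sequentially. a n \<le> ennreal (enn2real c + 1) * b n"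
  proof eventually_elim
    case (elim n)
    have cle: "c \<le> ennreal (enn2real c + 1)"
      using c(2) by (metis add.commute ennreal_enn2real enn2real_nonneg ennreal_leI
        infinity_ennreal_def le_add_same_cancel2 zero_le_one)
    \<comment> \<open>Division in \<open>ennreal\<close> is exceptional in the first two cases: a
      finite quotient by 0 forces \<open>a n = 0\<close>, and for \<open>b n = \<top>\<close> the
      right side is infinite because the added 1 makes the constant positive.\<close>
    consider "b n = 0" | "b n = \<top>" | "b n \<noteq> 0" "b n \<noteq> \<top>" by blast
    then show ?case
    proof cases
      case 1
      then have "a n = 0"
        using elim c(2) by (metis ennreal_divide_eq_top_iff less_asym top.not_eq_extremum infinity_ennreal_def)
      then show ?thesis by simp
    next
      case 2
      have "enn2real c + 1 > 0" by (simp add: add_nonneg_pos)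
      then show ?thesis using 2 by (simp add: ennreal_mult_top ennreal_eq_0_iff)
    next
      case 3
      have "a n = a n / b n * b n"
        using 3 by (simp add: ennreal_divide_times ennreal_divide_self mult.commute ennreal_times_divide
           ennreal_mult_divide_eq)
      also have "\<dots> \<le> ennreal (enn2real c + 1) * b n"
        using elim cle by (intro mult_right_mono) auto
      finally show ?thesis .
    qed
  qed
  then show ?thesis
    by (intro that[of "enn2real c + 1"]) (simp_all add: add_nonneg_pos)
qed

lemma asymp_leI:
  assumes "\<forall>\<^sub>F n in sequentially. a n \<le> ennreal C * b n"
    and "\<forall>\<^sub>F n in sequentially. b n \<noteq> 0 \<and> b n \<noteq> \<top>"
  shows "asymp_le a b"
proof -
  have "\<forall>\<^sub>F n in sequentially. a n / b n \<le> ennreal C"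
    using assms
  proof eventually_elim
    case (elim n)
    have "a n / b n \<le> (ennreal C * b n) / b n"
      using elim by (intro divide_right_mono_ennreal) auto
    also have "\<dots> = ennreal C"
      using elim by (simp add: ennreal_mult_divide_eq)
    finally show ?case .
  qed
  then have "limsup (\<lambda>n. a n / b n) \<le> ennreal C"
    by (rule Limsup_bounded)
  then show ?thesis
    unfolding asymp_le_def by (simp add: le_less_trans)
qed

section \<open>Exponential moments of sub-Gaussian noise\<close>

text \<open>Apart from the factor \<open>l\<^sup>2\<close>, the second-order Taylor remainder is
  \<open>exp t * z\<^sup>2 / 2\<close> with \<open>t \<le> \<bar>z\<bar>\<close>, and
  \<open>exp (2 * \<bar>z\<bar>)\<close> absorbs it. For a centred variable the linear term
  disappears in expectation, so a single exponential moment yields a bound quadratic in l.\<close>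

lemma exp_le_quadratic:
  fixes l z :: real
  assumes "\<bar>l\<bar> \<le> 1"
  shows "exp (l * z) \<le> 1 + l * z + l\<^sup>2 * exp (2 * \<bar>z\<bar>)"
proof -
  obtain t where t: "\<bar>t\<bar> \<le> \<bar>l * z\<bar>"
    "exp (l * z) = (\<Sum>m<2. (l * z) ^ m / fact m) + exp t / fact 2 * (l * z) ^ 2"
    using Maclaurin_exp_le[of "l * z" 2] by blast
  have "t \<le> \<bar>z\<bar>"
    using t(1) mult_right_mono[OF assms, of "\<bar>z\<bar>"] by (simp add: abs_mult)
  have "z\<^sup>2 / 2 \<le> exp \<bar>z\<bar>"
    using exp_lower_Taylor_quadratic[of "\<bar>z\<bar>"] by simp
  then have "exp t * (z\<^sup>2 / 2) \<le> exp \<bar>z\<bar> * exp \<bar>z\<bar>"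
    using \<open>t \<le> \<bar>z\<bar>\<close> by (intro mult_mono) auto
  then have "l\<^sup>2 * (exp t * (z\<^sup>2 / 2)) \<le> l\<^sup>2 * exp (2 * \<bar>z\<bar>)"
    by (intro mult_left_mono) (auto simp: exp_add[symmetric])
  then show ?thesis
    using t(2) by (simp add: lessThan_nat_numeral power_mult_distrib algebra_simps)
qed

lemma summable_exp_gaussian:
  fixes s :: real
  assumes "s > 0"
  shows "summable (\<lambda>k::nat. exp (2 * (real k + 1)) * (2 * exp (- (real k)\<^sup>2 / (2 * s\<^sup>2))))"
proof (rule summable_comparison_test)
  have "summable (\<lambda>k. (exp (- 1) :: real) ^ k)"
    by (rule summable_geometric) simp
  then show "summable (\<lambda>k. 2 * exp (2 + 9 * s\<^sup>2 / 2) * (exp (- 1) :: real) ^ k)"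
    by (rule summable_mult)
  have "exp (2 * (real k + 1)) * (2 * exp (- (real k)\<^sup>2 / (2 * s\<^sup>2)))
      \<le> 2 * exp (2 + 9 * s\<^sup>2 / 2) * (exp (- 1) :: real) ^ k" for k :: nat
  proof -
    \<comment> \<open>The centre \<open>3 * s\<^sup>2\<close> is the one that produces the linear
      term 3k: 2k compensates the growing factor and one more k leaves a geometric series.\<close>
    have "0 \<le> (real k - 3 * s\<^sup>2)\<^sup>2 / (2 * s\<^sup>2)"
      by simp
    also have "\<dots> = (real k)\<^sup>2 / (2 * s\<^sup>2) - 3 * real k + 9 * s\<^sup>2 / 2"
      using assms by (simp add: field_simps power2_eq_square)
    finally have "2 * (real k + 1) + - (real k)\<^sup>2 / (2 * s\<^sup>2) \<le> (2 + 9 * s\<^sup>2 / 2) + real k * (- 1)"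
      by simp
    then have "exp (2 * (real k + 1) + - (real k)\<^sup>2 / (2 * s\<^sup>2)) \<le> exp ((2 + 9 * s\<^sup>2 / 2) + real k * (- 1))"
      by (simp only: exp_le_cancel_iff)
    then show ?thesis
      unfolding exp_add exp_of_nat_mult by simp
  qed
  then show "\<exists>N. \<forall>k\<ge>N. norm (exp (2 * (real k + 1)) * (2 * exp (- (real k)\<^sup>2 / (2 * s\<^sup>2))))
      \<le> 2 * exp (2 + 9 * s\<^sup>2 / 2) * (exp (- 1) :: real) ^ k"
    by simp
qed

text \<open>The exponential is bounded on each slice where \<bar>Z\<bar> has integer part k. The
  overlapping tail events \<open>A k\<close> stand in for the slices, since only an upper bound is
  wanted. D is the sum of a series in s alone, hence common to all noise variables and all
  probability spaces.\<close>

lemma sub_gaussian_exp_moment: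
  fixes s :: real
  assumes "s > 0"
  obtains D where "D \<ge> 0"
    "\<And>(M :: 'w measure) Z. prob_space M \<Longrightarrow> Z \<in> borel_measurable M \<Longrightarrow>
       (\<And>t. t > 0 \<Longrightarrow> measure M {\<omega> \<in> space M. t \<le> \<bar>Z \<omega>\<bar>} \<le> 2 * exp (- t\<^sup>2 / (2 * s\<^sup>2))) \<Longrightarrow>
       (\<integral>\<^sup>+\<omega>. ennreal (exp (2 * \<bar>Z \<omega>\<bar>)) \<partial>M) \<le> ennreal D"
proof -
  define b where "b = (\<lambda>k::nat. exp (2 * (real k + 1)) * (2 * exp (- (real k)\<^sup>2 / (2 * s\<^sup>2))))"
  have sb: "summable b" unfolding b_def by (rule summable_exp_gaussian[OF assms])
  have b0: "b k \<ge> 0" for k by (simp add: b_def)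
  show ?thesis
  proof (rule that[of "suminf b"])
    show "suminf b \<ge> 0" using sb b0 by (rule suminf_nonneg)
    fix M :: "'w measure" and Z :: "'w \<Rightarrow> real"
    assume M: "prob_space M" and [measurable]: "Z \<in> borel_measurable M"
      and tail: "\<And>t. t > 0 \<Longrightarrow> measure M {\<omega> \<in> space M. t \<le> \<bar>Z \<omega>\<bar>} \<le> 2 * exp (- t\<^sup>2 / (2 * s\<^sup>2))"
    interpret prob_space M by (rule M)
    define A where "A = (\<lambda>k::nat. {\<omega> \<in> space M. real k \<le> \<bar>Z \<omega>\<bar>})"
    have [measurable]: "A k \<in> sets M" for k unfolding A_def by measurable
    \<comment> \<open>The tail hypothesis speaks of positive t only; at k = 0 the bound reads 2 and
      holds for any probability.\<close>
    have tail': "prob (A k) \<le> 2 * exp (- (real k)\<^sup>2 / (2 * s\<^sup>2))" for k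
      using tail[of "real k"] prob_le_1[of "A 0"] by (cases "k = 0") (auto simp: A_def prob_space)
    have "(\<integral>\<^sup>+\<omega>. ennreal (exp (2 * \<bar>Z \<omega>\<bar>)) \<partial>M)
        \<le> (\<integral>\<^sup>+\<omega>. (\<Sum>k. ennreal (exp (2 * (real k + 1))) * indicator (A k) \<omega>) \<partial>M)"
    proof (rule nn_integral_mono)
      fix \<omega> assume w: "\<omega> \<in> space M"
      define k where "k = nat \<lfloor>\<bar>Z \<omega>\<bar>\<rfloor>"
      have k: "real k \<le> \<bar>Z \<omega>\<bar>" "\<bar>Z \<omega>\<bar> \<le> real k + 1" unfolding k_def by linarith+
      define F where "F = (\<lambda>k. ennreal (exp (2 * (real k + 1))) * indicator (A k) \<omega>)"
      have "ennreal (exp (2 * \<bar>Z \<omega>\<bar>)) \<le> F k"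
        using k w by (simp add: A_def F_def ennreal_leI)
      also have "F k = (\<Sum>j\<in>{k}. F j)" by simp
      also have "\<dots> \<le> suminf F" by (rule sum_le_suminf) auto
      finally show "ennreal (exp (2 * \<bar>Z \<omega>\<bar>))
          \<le> (\<Sum>k. ennreal (exp (2 * (real k + 1))) * indicator (A k) \<omega>)"
        by (simp only: F_def)
    qed
    also have "\<dots> = (\<Sum>k. \<integral>\<^sup>+\<omega>. ennreal (exp (2 * (real k + 1))) * indicator (A k) \<omega> \<partial>M)"
      by (rule nn_integral_suminf) measurable
    also have "\<dots> = (\<Sum>k. ennreal (exp (2 * (real k + 1)) * prob (A k)))"
      by (simp add: nn_integral_cmult_indicator emeasure_eq_measure ennreal_mult)
    also have "\<dots> \<le> (\<Sum>k. ennreal (b k))"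
      unfolding b_def by (intro suminf_le ennreal_leI mult_left_mono tail') auto
    also have "\<dots> = ennreal (suminf b)"
      using sb b0 by (intro suminf_ennreal2) auto
    finally show "(\<integral>\<^sup>+\<omega>. ennreal (exp (2 * \<bar>Z \<omega>\<bar>)) \<partial>M) \<le> ennreal (suminf b)" .
  qed
qed

text \<open>Taking expectations in \<open>exp_le_quadratic\<close> removes the linear term because Z
  is centred, and 1 + x \<le> exp x gives the Gaussian form, which multiplies well over independent
  summands.\<close>

lemma (in prob_space) mgf_bound:
  fixes Z :: "'a \<Rightarrow> real"
  assumes "D \<ge> 0" and "integrable M Z" and "expectation Z = 0"
    and mom: "(\<integral>\<^sup>+\<omega>. ennreal (exp (2 * \<bar>Z \<omega>\<bar>)) \<partial>M) \<le> ennreal D" and "\<bar>l\<bar> \<le> 1"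
  shows "(\<integral>\<^sup>+\<omega>. ennreal (exp (l * Z \<omega>)) \<partial>M) \<le> ennreal (exp (D * l\<^sup>2))"
proof -
  have [measurable]: "Z \<in> borel_measurable M" using assms(2) by auto
  have i2: "integrable M (\<lambda>\<omega>. exp (2 * \<bar>Z \<omega>\<bar>))"
    using mom by (intro integrableI_bounded) (auto simp: le_less_trans)
  have "expectation (\<lambda>\<omega>. exp (2 * \<bar>Z \<omega>\<bar>)) \<le> D"
    using mom i2 assms(1) by (subst (asm) nn_integral_eq_integral) auto
  have "(\<integral>\<^sup>+\<omega>. ennreal (exp (l * Z \<omega>)) \<partial>M)
      \<le> (\<integral>\<^sup>+\<omega>. ennreal (1 + l * Z \<omega> + l\<^sup>2 * exp (2 * \<bar>Z \<omega>\<bar>)) \<partial>M)"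
    by (intro nn_integral_mono ennreal_leI exp_le_quadratic assms)
  also have "\<dots> = ennreal (expectation (\<lambda>\<omega>. 1 + l * Z \<omega> + l\<^sup>2 * exp (2 * \<bar>Z \<omega>\<bar>)))"
  proof (rule nn_integral_eq_integral)
    show "AE \<omega> in M. 0 \<le> 1 + l * Z \<omega> + l\<^sup>2 * exp (2 * \<bar>Z \<omega>\<bar>)"
      using exp_le_quadratic[OF assms(5)] by (intro AE_I2) (meson exp_ge_zero order_trans)
  qed (use i2 assms in auto)
  also have "expectation (\<lambda>\<omega>. 1 + l * Z \<omega> + l\<^sup>2 * exp (2 * \<bar>Z \<omega>\<bar>))
      = 1 + l\<^sup>2 * expectation (\<lambda>\<omega>. exp (2 * \<bar>Z \<omega>\<bar>))"
    using i2 assms by (simp add: prob_space)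
  also have "ennreal \<dots> \<le> ennreal (exp (D * l\<^sup>2))"
  proof (rule ennreal_leI)
    have "l\<^sup>2 * expectation (\<lambda>\<omega>. exp (2 * \<bar>Z \<omega>\<bar>)) \<le> l\<^sup>2 * D"
      by (intro mult_left_mono) (fact, simp)
    moreover have "1 + l\<^sup>2 * D \<le> exp (D * l\<^sup>2)"
      unfolding mult.commute[of D] by (rule exp_ge_add_one_self)
    ultimately show "1 + l\<^sup>2 * expectation (\<lambda>\<omega>. exp (2 * \<bar>Z \<omega>\<bar>)) \<le> exp (D * l\<^sup>2)"
      by linarith
  qed
  finally show ?thesis .
qed

text \<open>Nonnegative integrals factor over independent variables without integrability
  conditions, and the quadratic exponents add up. The weights are limited to 1 because the single
  bounds hold only for \<open>\<bar>l\<bar> \<le> 1\<close>.\<close>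

lemma (in prob_space) mgf_weighted_sum_bound:
  fixes Z :: "'i \<Rightarrow> 'a \<Rightarrow> real"
  assumes "finite I" and "indep_vars (\<lambda>_. borel) Z I"
    and mgf: "\<And>i l. i \<in> I \<Longrightarrow> \<bar>l\<bar> \<le> 1 \<Longrightarrow> (\<integral>\<^sup>+\<omega>. ennreal (exp (l * Z i \<omega>)) \<partial>M) \<le> ennreal (exp (D * l\<^sup>2))"
    and w: "\<And>i. i \<in> I \<Longrightarrow> \<bar>w i\<bar> \<le> 1"
  shows "(\<integral>\<^sup>+\<omega>. ennreal (exp (\<Sum>i\<in>I. w i * Z i \<omega>)) \<partial>M) \<le> ennreal (exp (D * (\<Sum>i\<in>I. (w i)\<^sup>2)))"
proof -
  have "indep_vars (\<lambda>_. borel) (\<lambda>i \<omega>. ennreal (exp (w i * Z i \<omega>))) I"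
    using assms(2) by (rule indep_vars_compose2) measurable
  then have "(\<integral>\<^sup>+\<omega>. (\<Prod>i\<in>I. ennreal (exp (w i * Z i \<omega>))) \<partial>M)
      = (\<Prod>i\<in>I. \<integral>\<^sup>+\<omega>. ennreal (exp (w i * Z i \<omega>)) \<partial>M)"
    using assms(1) by (intro indep_vars_nn_integral) auto
  also have "\<dots> \<le> (\<Prod>i\<in>I. ennreal (exp (D * (w i)\<^sup>2)))"
    by (intro prod_mono_ennreal mgf w)
  finally show ?thesis
    using assms(1) by (simp add: prod_ennreal exp_sum sum_distrib_left)
qed

section \<open>The local design\<close>

text \<open>Kernel values are always taken at \<open>\<bar>z\<bar>\<close>, so that z can be the
  signed scaled time (t_i - t) / h. The interval from a to a + 3 * w has three thirds on purpose:
  design points in its outer thirds are at least w apart and so pin down an affine function.\<close>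

locale local_kernel =
  fixes K :: "real \<Rightarrow> real" and C L a w c :: real
  assumes C_pos: "C > 0" and L_nonneg: "L \<ge> 0"
    and a_nonneg: "0 \<le> a" and w_pos: "w > 0" and aw_le: "a + 3 * w \<le> 1" and c_pos: "c > 0"
    and K_nonneg: "\<And>z. 0 \<le> K \<bar>z\<bar>" and K_le: "\<And>z. K \<bar>z\<bar> \<le> C"
    and K_zero: "\<And>z. 1 \<le> \<bar>z\<bar> \<Longrightarrow> K \<bar>z\<bar> = 0"
    and K_ge: "\<And>z. a \<le> \<bar>z\<bar> \<Longrightarrow> \<bar>z\<bar> \<le> a + 3 * w \<Longrightarrow> c \<le> K \<bar>z\<bar>"
    and K_lipschitz: "\<And>z z'. \<bar>K (\<bar>z\<bar>) - K (\<bar>z'\<bar>)\<bar> \<le> L * \<bar>z - z'\<bar>"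

lemma kernel_assumptionE:
  assumes "kernel_assumption K"
  obtains C L a w c where "local_kernel K C L a w c"
proof -
  obtain L where L: "L-lipschitz_on {0..} K"
    using assms by (auto simp: kernel_assumption_def)
  obtain C where C: "C > 0" "\<And>z. z \<ge> 0 \<Longrightarrow> K z \<le> C * indicator {0..1} z"
    using assms by (auto simp: kernel_assumption_def)
  have K0: "0 \<le> K z" if "z \<ge> 0" for z
    using assms that by (auto simp: kernel_assumption_def)
  have L0: "L \<ge> 0" using L by (rule lipschitz_on_nonneg)
  have lip: "\<bar>K x - K y\<bar> \<le> L * \<bar>x - y\<bar>" if "x \<ge> 0" "y \<ge> 0" for x y
    using lipschitz_onD[OF L, of x y] that by (simp add: dist_real_def)
  have KC: "K z \<le> C" if "z \<ge> 0" for z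
    using C(2)[OF that] C(1) by (cases "z \<le> 1") (auto simp: that)
  have Kgt: "K z = 0" if "z > 1" for z
    using C(2)[of z] K0[of z] that by simp
  \<comment> \<open>K vanishes beyond 1, so continuity forces this: at distance e the Lipschitz
    bound would give K 1 \<le> L * e < (L + 1) * e = K 1. Consequently a point with K a > 0 lies
    strictly below 1 and has room on its right.\<close>
  have K1: "K 1 = 0"
  proof (rule ccontr)
    assume "K 1 \<noteq> 0"
    then have pos: "K 1 > 0" using K0[of 1] by simp
    define e where "e = K 1 / (L + 1)"
    have "e > 0" using pos L0 by (simp add: e_def)
    then have "K 1 \<le> L * e" using lip[of 1 "1 + e"] Kgt[of "1 + e"] by simp
    moreover have "K 1 = (L + 1) * e" using L0 by (simp add: e_def)
    ultimately show False using \<open>e > 0\<close> by (simp add: distrib_right)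
  qed
  have Kge: "K \<bar>z\<bar> = 0" if "1 \<le> \<bar>z\<bar>" for z
    using that K1 Kgt[of "\<bar>z\<bar>"] by (cases "\<bar>z\<bar> = 1") auto
  obtain a where a: "a \<ge> 0" "K a \<noteq> 0"
    using assms by (auto simp: kernel_assumption_def)
  have a1: "a < 1" using Kge[of a] a by (cases "a < 1") auto
  have Ka: "K a > 0" using a K0[of a] by simp
  \<comment> \<open>The first term keeps a + 3 * w below 1; the second keeps K above K a / 2 as far
    as a + 3 * w, by the Lipschitz bound. L + 1 stays positive when L = 0.\<close>
  define w where "w = min ((1 - a) / 3) (K a / (6 * (L + 1)))"
  have w: "w > 0" "a + 3 * w \<le> 1" using a1 Ka L0 by (auto simp: w_def min_def field_simps)
  have "L * (3 * w) \<le> (L + 1) * (3 * w)" using w by simp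
  also have "\<dots> \<le> (L + 1) * (3 * (K a / (6 * (L + 1))))"
    using L0 by (intro mult_left_mono) (auto simp: w_def)
  also have "\<dots> = K a / 2" using L0 by (simp add: field_simps)
  finally have Lw: "L * (3 * w) \<le> K a / 2" .
  show ?thesis
  proof (rule that[of C L a w "K a / 2"], unfold_locales)
    fix z :: real assume z: "a \<le> \<bar>z\<bar>" "\<bar>z\<bar> \<le> a + 3 * w"
    have "L * \<bar>a - \<bar>z\<bar>\<bar> \<le> L * (3 * w)" using z L0 by (intro mult_left_mono) auto
    then show "K a / 2 \<le> K \<bar>z\<bar>" using lip[of a "\<bar>z\<bar>"] Lw a by auto
  next
    fix z z' :: real
    have "L * \<bar>\<bar>z\<bar> - \<bar>z'\<bar>\<bar> \<le> L * \<bar>z - z'\<bar>" using L0 by (intro mult_left_mono) auto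
    then show "\<bar>K (\<bar>z\<bar>) - K (\<bar>z'\<bar>)\<bar> \<le> L * \<bar>z - z'\<bar>" using lip[of "\<bar>z\<bar>" "\<bar>z'\<bar>"] by simp
  qed (use C L0 a w Ka K0 KC Kge in auto)
qed

text \<open>The unbounded factor is harmless because k vanishes outside the unit interval: in the
  product rule, the point that multiplies the increment of k can be chosen in [-1, 1]. This lets the
  slope weights \<open>K \<bar>z\<bar> * z\<close> go through the same noise bound as
  \<open>K \<bar>z\<bar>\<close>.\<close>

lemma lipschitz_first_moment:
  fixes k :: "real \<Rightarrow> real"
  assumes "C \<ge> 0" "L \<ge> 0" "\<And>z. \<bar>k z\<bar> \<le> C" "\<And>z. 1 \<le> \<bar>z\<bar> \<Longrightarrow> k z = 0"
    and lip: "\<And>z z'. \<bar>k z - k z'\<bar> \<le> L * \<bar>z - z'\<bar>"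
  shows "\<bar>k z * z - k z' * z'\<bar> \<le> (C + L) * \<bar>z - z'\<bar>"
proof -
  have *: "\<bar>k x * x - k y * y\<bar> \<le> (C + L) * \<bar>x - y\<bar>" if "\<bar>x\<bar> \<le> 1" for x y
  proof -
    have "k x * x - k y * y = k y * (x - y) + x * (k x - k y)" by (simp add: algebra_simps)
    then have "\<bar>k x * x - k y * y\<bar> \<le> \<bar>k y\<bar> * \<bar>x - y\<bar> + \<bar>x\<bar> * \<bar>k x - k y\<bar>"
      by (metis abs_mult abs_triangle_ineq)
    also have "\<dots> \<le> C * \<bar>x - y\<bar> + 1 * (L * \<bar>x - y\<bar>)"
      using assms that by (intro add_mono mult_mono) auto
    finally show ?thesis by (simp add: algebra_simps)
  qed
  consider "\<bar>z\<bar> \<le> 1" | "\<bar>z'\<bar> \<le> 1" | "1 \<le> \<bar>z\<bar>" "1 \<le> \<bar>z'\<bar>" by linarith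
  then show ?thesis
  proof cases
    case 1 then show ?thesis by (rule *)
  next
    case 2 then show ?thesis using *[of z' z] by (simp add: abs_minus_commute)
  next
    case 3 then show ?thesis using assms by simp
  qed
qed

lemma card_grid_ge:
  fixes p q s :: real
  assumes "s > 0" "0 \<le> p" "p \<le> q" "q \<le> real n * s"
  shows "(q - p) / s - 1 \<le> real (card {i \<in> {1..n}. p \<le> real i * s \<and> real i * s \<le> q})"
proof -
  define l where "l = nat \<lfloor>p / s\<rfloor>"
  define r where "r = nat \<lfloor>q / s\<rfloor>"
  have l: "real l \<le> p / s" "p / s < real l + 1"
    using assms by (simp_all add: l_def)
  have "q / s \<ge> 0" using assms by simp
  then have r: "real r \<le> q / s" "q / s < real r + 1"
    by (simp_all add: r_def)
  \<comment> \<open>Dropping index l, even when l * s equals p, keeps all indices positive; the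
    count r - l still loses at most 1.\<close>
  have "{l + 1..r} \<subseteq> {i \<in> {1..n}. p \<le> real i * s \<and> real i * s \<le> q}"
  proof
    fix i assume i: "i \<in> {l + 1..r}"
    then have "p / s \<le> real i" "real i \<le> q / s" using l r by auto
    then have "p \<le> real i * s" "real i * s \<le> q" using assms by (simp_all add: field_simps)
    moreover have "i \<le> n"
    proof -
      have "real i * s \<le> real n * s" using \<open>real i * s \<le> q\<close> assms by linarith
      then show ?thesis using assms by simp
    qed
    ultimately show "i \<in> {i \<in> {1..n}. p \<le> real i * s \<and> real i * s \<le> q}" using i by simp
  qed
  then have "card {l + 1..r} \<le> card {i \<in> {1..n}. p \<le> real i * s \<and> real i * s \<le> q}"
    by (intro card_mono) auto
  moreover have "real r - real l \<le> real (card {l + 1..r})" by simp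
  ultimately show ?thesis using l r by (simp add: diff_divide_distrib)
qed

lemma card_window_le:
  fixes s h t :: real
  assumes "s > 0" "h > 0"
  shows "real (card {i \<in> {1..n}. \<bar>(real i * s - t) / h\<bar> \<le> 1}) \<le> 2 * (h / s) + 1"
proof -
  let ?A = "{i \<in> {1..n}. \<bar>(real i * s - t) / h\<bar> \<le> 1}"
  \<comment> \<open>The window may start at a negative time, so the count is made among
    integers.\<close>
  have "int ` ?A \<subseteq> {\<lceil>(t - h) / s\<rceil>..\<lfloor>(t + h) / s\<rfloor>}"
  proof
    fix j assume "j \<in> int ` ?A"
    then obtain i where i: "j = int i" "\<bar>(real i * s - t) / h\<bar> \<le> 1" by auto
    then have "\<bar>real i * s - t\<bar> \<le> h" using assms by (simp add: abs_divide)
    then have "(t - h) / s \<le> real i" "real i \<le> (t + h) / s"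
      using assms by (simp_all add: field_simps)
    then show "j \<in> {\<lceil>(t - h) / s\<rceil>..\<lfloor>(t + h) / s\<rfloor>}"
      using i by (simp add: ceiling_le_iff le_floor_iff)
  qed
  then have "card (int ` ?A) \<le> card {\<lceil>(t - h) / s\<rceil>..\<lfloor>(t + h) / s\<rfloor>}"
    by (intro card_mono) auto
  also have "card (int ` ?A) = card ?A"
    by (intro card_image) auto
  finally have "real (card ?A) \<le> real (nat (\<lfloor>(t + h) / s\<rfloor> - \<lceil>(t - h) / s\<rceil> + 1))"
    by simp
  also have "\<dots> \<le> (t + h) / s - (t - h) / s + 1"
  proof -
    have "(t + h) / s - (t - h) / s \<ge> 0" using assms by (simp add: field_simps)
    then show ?thesis by linarith
  qed
  also have "\<dots> = 2 * (h / s) + 1" using assms by (simp add: field_simps)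
  finally show ?thesis .
qed

text \<open>Two values of an affine function at points w apart determine it stably. Their difference
  gives the slope, at the price 2 / w^2; the intercept is then recovered from the value at y, which
  is why only y has to lie in [-1, 1].\<close>

lemma affine_two_point_bound:
  fixes \<alpha> \<beta> :: "'a::real_inner" and y z w :: real
  assumes "w > 0" "\<bar>y\<bar> \<le> 1" "w \<le> \<bar>y - z\<bar>"
  shows "(norm \<alpha>)\<^sup>2 + (norm \<beta>)\<^sup>2
    \<le> (2 + 6 / w\<^sup>2) * ((norm (\<alpha> + y *\<^sub>R \<beta>))\<^sup>2 + (norm (\<alpha> + z *\<^sub>R \<beta>))\<^sup>2)"
proof -
  define P where "P = (norm (\<alpha> + y *\<^sub>R \<beta>))\<^sup>2 + (norm (\<alpha> + z *\<^sub>R \<beta>))\<^sup>2"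
  have sq: "(norm (x - x'))\<^sup>2 \<le> 2 * (norm x)\<^sup>2 + 2 * (norm x')\<^sup>2" for x x' :: 'a
  proof -
    have "(norm (x - x'))\<^sup>2 \<le> (norm x + norm x')\<^sup>2"
      by (intro power_mono norm_triangle_ineq4) simp
    also have "\<dots> \<le> 2 * (norm x)\<^sup>2 + 2 * (norm x')\<^sup>2"
      using sum_squares_bound[of "norm x" "norm x'"] by (simp add: power2_sum)
    finally show ?thesis .
  qed
  have "(y - z) *\<^sub>R \<beta> = (\<alpha> + y *\<^sub>R \<beta>) - (\<alpha> + z *\<^sub>R \<beta>)" by (simp add: algebra_simps)
  then have "\<bar>y - z\<bar>\<^sup>2 * (norm \<beta>)\<^sup>2 \<le> 2 * P"
    using sq[of "\<alpha> + y *\<^sub>R \<beta>" "\<alpha> + z *\<^sub>R \<beta>"]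
    by (metis P_def distrib_left norm_scaleR power_mult_distrib)
  moreover have "w\<^sup>2 * (norm \<beta>)\<^sup>2 \<le> \<bar>y - z\<bar>\<^sup>2 * (norm \<beta>)\<^sup>2"
    using assms by (intro mult_right_mono power_mono) auto
  ultimately have b: "(norm \<beta>)\<^sup>2 \<le> 2 * P / w\<^sup>2"
    using assms by (simp add: field_simps)
  have "\<alpha> = (\<alpha> + y *\<^sub>R \<beta>) - y *\<^sub>R \<beta>" by simp
  then have "(norm \<alpha>)\<^sup>2 \<le> 2 * (norm (\<alpha> + y *\<^sub>R \<beta>))\<^sup>2 + 2 * (norm (y *\<^sub>R \<beta>))\<^sup>2"
    using sq by metis
  also have "(norm (y *\<^sub>R \<beta>))\<^sup>2 \<le> (norm \<beta>)\<^sup>2"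
    using assms by (intro power_mono) (auto intro: mult_left_le_one_le)
  also have "(norm (\<alpha> + y *\<^sub>R \<beta>))\<^sup>2 \<le> P" by (simp add: P_def)
  finally have "(norm \<alpha>)\<^sup>2 + (norm \<beta>)\<^sup>2 \<le> 2 * P + 3 * (norm \<beta>)\<^sup>2" by simp
  also have "\<dots> \<le> 2 * P + 3 * (2 * P / w\<^sup>2)" using b by simp
  also have "\<dots> = (2 + 6 / w\<^sup>2) * P" by (simp add: algebra_simps)
  finally show ?thesis by (simp add: P_def)
qed

text \<open>The bandwidth condition \<open>2 * h \<le> T\<close> leaves a full window on at least one side of every
  \<open>t\<close>, so the boundary needs no separate treatment.\<close>

definition (in local_kernel) gram_const :: real where
  "gram_const = c * w / (4 * (2 + 6 / w\<^sup>2))"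

text \<open>Two blocks of scaled times, in the outer thirds of the interval where K \<ge> c, replace
  a limit of the design matrix. If the affine function is large on all of the first block, that
  block suffices. Otherwise it is small at some point there, and
  \<open>affine_two_point_bound\<close> makes it large at every point of the second block. A block
  has at least w * (h / s) / 2 points, each contributing at least c * P / (2 * \<kappa>); this gives
  the value of \<open>gram_const\<close>.\<close>

lemma (in local_kernel) gram_lower_bound:
  fixes \<alpha> \<beta> :: "'a::real_inner"
  assumes s: "s > 0" and h: "h > 0" "2 * h \<le> real n * s" "2 \<le> w * (h / s)"
    and t: "0 \<le> t" "t \<le> real n * s"
  shows "gram_const * (h / s) * ((norm \<alpha>)\<^sup>2 + (norm \<beta>)\<^sup>2)
    \<le> (\<Sum>i=1..n. K \<bar>(real i * s - t) / h\<bar> * (norm (\<alpha> + ((real i * s - t) / h) *\<^sub>R \<beta>))\<^sup>2)"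
proof -
  note K0 = K_nonneg and aw = a_nonneg w_pos aw_le c_pos and Kc = K_ge
  define z where "z = (\<lambda>i::nat. (real i * s - t) / h)"
  define q where "q = (\<lambda>x. (norm (\<alpha> + x *\<^sub>R \<beta>))\<^sup>2)"
  define P where "P = (norm \<alpha>)\<^sup>2 + (norm \<beta>)\<^sup>2"
  define \<kappa> where "\<kappa> = 2 + 6 / w\<^sup>2"
  have \<kappa>: "\<kappa> > 0" using aw by (simp add: \<kappa>_def add_pos_nonneg)
  \<comment> \<open>The sign selects a side of t with a full half-window. If t + h exceeds the time
    horizon, \<open>2 * h \<le> real n * s\<close> yields t - h \<ge> 0.\<close>
  define e :: real where "e = (if t + h \<le> real n * s then 1 else - 1)"
  have e: "\<bar>e\<bar> = 1" "e * e = 1" by (auto simp: e_def)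
  define J where "J = (\<lambda>x. {i \<in> {1..n}. x \<le> e * z i \<and> e * z i \<le> x + w})"
  \<comment> \<open>The 1 lost in \<open>card_grid_ge\<close> is at most half of w * (h / s),
    because \<open>2 \<le> w * (h / s)\<close>.\<close>
  have cardJ: "w * (h / s) / 2 \<le> real (card (J x))" if x: "0 \<le> x" "x + w \<le> 1" for x
  proof (cases "t + h \<le> real n * s")
    case True
    have "J x = {i \<in> {1..n}. t + x * h \<le> real i * s \<and> real i * s \<le> t + (x + w) * h}"
      using True h by (auto simp: J_def e_def z_def field_simps)
    moreover have "(x + w) * h \<le> 1 * h" using x h by (intro mult_right_mono) auto
    then have "t + (x + w) * h \<le> real n * s" using True by linarith
    moreover have "t + x * h \<le> t + (x + w) * h" "0 \<le> t + x * h"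
      using t x h aw by (auto intro: mult_right_mono)
    ultimately have "(t + (x + w) * h - (t + x * h)) / s - 1 \<le> real (card (J x))"
      using s by (simp only:) (rule card_grid_ge)
    then show ?thesis using h by (simp add: algebra_simps)
  next
    case False
    have "J x = {i \<in> {1..n}. t - (x + w) * h \<le> real i * s \<and> real i * s \<le> t - x * h}"
      using False h by (auto simp: J_def e_def z_def field_simps)
    moreover have "(x + w) * h \<le> 1 * h" using x h by (intro mult_right_mono) auto
    then have "0 \<le> t - (x + w) * h" using False h by linarith
    moreover have "0 \<le> x * h" using x h by simp
    then have "t - x * h \<le> real n * s" using t by linarith
    moreover have "t - (x + w) * h \<le> t - x * h"
      using h aw by (auto intro: mult_right_mono)
    ultimately have "(t - x * h - (t - (x + w) * h)) / s - 1 \<le> real (card (J x))"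
      using s by (simp only:) (rule card_grid_ge)
    then show ?thesis using h by (simp add: algebra_simps)
  qed
  have abs_z: "\<bar>z i\<bar> = e * z i" if "0 \<le> e * z i" for i
    using that by (auto simp: e_def split: if_splits)
  have lower: "w * (h / s) / 2 * (c * (P / (2 * \<kappa>))) \<le> (\<Sum>i=1..n. K \<bar>z i\<bar> * q (z i))"
    if x: "a \<le> x" "x + w \<le> a + 3 * w" and big: "\<And>i. i \<in> J x \<Longrightarrow> P / (2 * \<kappa>) \<le> q (z i)" for x
  proof -
    have "w * (h / s) / 2 * (c * (P / (2 * \<kappa>))) \<le> real (card (J x)) * (c * (P / (2 * \<kappa>)))"
      using x aw \<kappa> by (intro mult_right_mono cardJ) (auto simp: P_def)
    also have "\<dots> = (\<Sum>i\<in>J x. c * (P / (2 * \<kappa>)))" by simp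
    also have "\<dots> \<le> (\<Sum>i\<in>J x. K \<bar>z i\<bar> * q (z i))"
    proof (intro sum_mono mult_mono big)
      fix i assume i: "i \<in> J x"
      then have "\<bar>z i\<bar> = e * z i" using x aw by (intro abs_z) (auto simp: J_def)
      then show "c \<le> K \<bar>z i\<bar>" using i x by (intro Kc) (auto simp: J_def)
    qed (use K0 \<kappa> in \<open>auto simp: P_def\<close>)
    also have "\<dots> \<le> (\<Sum>i=1..n. K \<bar>z i\<bar> * q (z i))"
      using K0 by (intro sum_mono2) (auto simp: J_def q_def)
    finally show ?thesis .
  qed
  have "w * (h / s) / 2 * (c * (P / (2 * \<kappa>))) \<le> (\<Sum>i=1..n. K \<bar>z i\<bar> * q (z i))"
  proof (cases "\<forall>i\<in>J a. P / (2 * \<kappa>) \<le> q (z i)")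
    case True
    then show ?thesis using aw by (intro lower[of a]) auto
  next
    case False
    then obtain i where i: "i \<in> J a" "q (z i) < P / (2 * \<kappa>)" by auto
    show ?thesis
    proof (rule lower[of "a + 2 * w"])
      fix j assume j: "j \<in> J (a + 2 * w)"
      have "\<bar>z i\<bar> \<le> 1" using i aw abs_z[of i] by (auto simp: J_def)
      moreover have "w \<le> \<bar>z i - z j\<bar>"
        using i j aw e by (auto simp: J_def e_def split: if_splits)
      ultimately have "P \<le> \<kappa> * (q (z i) + q (z j))"
        unfolding P_def \<kappa>_def q_def using aw by (intro affine_two_point_bound) auto
      then have "P / \<kappa> \<le> q (z i) + q (z j)" using \<kappa> by (simp add: field_simps)
      then show "P / (2 * \<kappa>) \<le> q (z j)" using i by simp
    qed (use aw in auto)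
  qed
  then show ?thesis
    by (simp add: z_def q_def P_def \<kappa>_def gram_const_def field_simps)
qed

section \<open>Weighted least squares\<close>

lemma linear_coefficient_zero:
  fixes B Q :: real
  assumes "\<And>x. 0 \<le> x\<^sup>2 * Q - 2 * x * B" "Q \<ge> 0"
  shows "B = 0"
proof (rule ccontr)
  assume "B \<noteq> 0"
  \<comment> \<open>The minimizer of the quadratic would be B / Q; the denominator Q + 1 covers Q =
    0 as well and still gives a negative value.\<close>
  define x where "x = B / (Q + 1)"
  have x: "x \<noteq> 0" "B = x * (Q + 1)"
    using \<open>B \<noteq> 0\<close> assms(2) by (auto simp: x_def)
  have "0 \<le> x\<^sup>2 * Q - 2 * x * B" by (rule assms)
  also have "\<dots> = - (x\<^sup>2 * (Q + 2))"
    unfolding x(2) by (simp add: algebra_simps power2_eq_square)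
  also have "\<dots> < 0" using x(1) assms(2) by (simp add: mult_pos_pos)
  finally show False by simp
qed

text \<open>Moving the minimizer by x in a direction (a, b) changes the loss by a quadratic in x
  without constant term. As this change is never negative, its linear coefficient vanishes, for
  every direction.\<close>

lemma weighted_least_squares_normal_equations:
  fixes y :: "'i \<Rightarrow> 'a::real_inner"
  assumes k0: "\<And>i. i \<in> I \<Longrightarrow> k i \<ge> 0"
    and min: "\<And>a b. (\<Sum>i\<in>I. (norm (y i - \<theta>\<^sub>0 - z i *\<^sub>R \<theta>\<^sub>1))\<^sup>2 * k i)
                 \<le> (\<Sum>i\<in>I. (norm (y i - a - z i *\<^sub>R b))\<^sup>2 * k i)"
  shows "(\<Sum>i\<in>I. k i *\<^sub>R (y i - \<theta>\<^sub>0 - z i *\<^sub>R \<theta>\<^sub>1)) = 0"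
    and "(\<Sum>i\<in>I. (k i * z i) *\<^sub>R (y i - \<theta>\<^sub>0 - z i *\<^sub>R \<theta>\<^sub>1)) = 0"
proof -
  define r where "r = (\<lambda>i. y i - \<theta>\<^sub>0 - z i *\<^sub>R \<theta>\<^sub>1)"
  have B: "(\<Sum>i\<in>I. k i * (r i \<bullet> (a + z i *\<^sub>R b))) = 0" for a b
  proof (rule linear_coefficient_zero)
    fix x :: real
    have "(\<Sum>i\<in>I. (norm (r i))\<^sup>2 * k i)
        \<le> (\<Sum>i\<in>I. (norm (r i - x *\<^sub>R (a + z i *\<^sub>R b)))\<^sup>2 * k i)"
      using min[of "\<theta>\<^sub>0 + x *\<^sub>R a" "\<theta>\<^sub>1 + x *\<^sub>R b"] by (simp add: r_def algebra_simps)
    also have "\<dots> = (\<Sum>i\<in>I. (norm (r i))\<^sup>2 * k i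
        + (x\<^sup>2 * (k i * (norm (a + z i *\<^sub>R b))\<^sup>2) - 2 * x * (k i * (r i \<bullet> (a + z i *\<^sub>R b)))))"
    proof (rule sum.cong[OF refl])
      fix i
      have "(norm (r i - x *\<^sub>R v))\<^sup>2 = (norm (r i))\<^sup>2 + x\<^sup>2 * (norm v)\<^sup>2 - 2 * x * (r i \<bullet> v)" for v
        unfolding power2_norm_eq_inner
        by (simp add: inner_diff_left inner_diff_right inner_commute power2_eq_square)
      then show "(norm (r i - x *\<^sub>R (a + z i *\<^sub>R b)))\<^sup>2 * k i = (norm (r i))\<^sup>2 * k i
        + (x\<^sup>2 * (k i * (norm (a + z i *\<^sub>R b))\<^sup>2) - 2 * x * (k i * (r i \<bullet> (a + z i *\<^sub>R b))))"
        by (simp only:) (simp add: algebra_simps)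
    qed
    finally show "0 \<le> x\<^sup>2 * (\<Sum>i\<in>I. k i * (norm (a + z i *\<^sub>R b))\<^sup>2)
        - 2 * x * (\<Sum>i\<in>I. k i * (r i \<bullet> (a + z i *\<^sub>R b)))"
      by (simp add: sum.distrib sum_subtractf sum_distrib_left)
  qed (auto intro!: sum_nonneg mult_nonneg_nonneg k0)
  have "(\<Sum>i\<in>I. k i *\<^sub>R r i) \<bullet> a = 0" for a
    using B[of a 0] by (simp add: inner_sum_left)
  moreover have "(\<Sum>i\<in>I. (k i * z i) *\<^sub>R r i) \<bullet> b = 0" for b
    using B[of 0 b] by (simp add: inner_sum_left mult.assoc)
  ultimately show "(\<Sum>i\<in>I. k i *\<^sub>R (y i - \<theta>\<^sub>0 - z i *\<^sub>R \<theta>\<^sub>1)) = 0"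
    and "(\<Sum>i\<in>I. (k i * z i) *\<^sub>R (y i - \<theta>\<^sub>0 - z i *\<^sub>R \<theta>\<^sub>1)) = 0"
    unfolding r_def by (metis inner_eq_zero_iff)+
qed

text \<open>The residuals at \<open>(\<eta>\<^sub>0, \<eta>\<^sub>1)\<close> differ from those at
  the minimizer by the affine function of the error, and the normal equations cancel the latter
  residuals in both weighted sums. Pairing these sums with the error itself gives the Gram form on
  one side and Cauchy-Schwarz on the other. The comparison pair is arbitrary: it will be the truth
  for the error bound and a fit at another time for continuity.\<close>

lemma weighted_least_squares_error:
  fixes y :: "'i \<Rightarrow> 'a::real_inner"
  assumes k0: "\<And>i. i \<in> I \<Longrightarrow> k i \<ge> 0"
    and min: "\<And>a b. (\<Sum>i\<in>I. (norm (y i - \<theta>\<^sub>0 - z i *\<^sub>R \<theta>\<^sub>1))\<^sup>2 * k i)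
                 \<le> (\<Sum>i\<in>I. (norm (y i - a - z i *\<^sub>R b))\<^sup>2 * k i)"
    and gram: "\<And>a b :: 'a. g * ((norm a)\<^sup>2 + (norm b)\<^sup>2) \<le> (\<Sum>i\<in>I. k i * (norm (a + z i *\<^sub>R b))\<^sup>2)"
    and "g > 0"
  shows "norm (\<theta>\<^sub>0 - \<eta>\<^sub>0, \<theta>\<^sub>1 - \<eta>\<^sub>1)
    \<le> (norm (\<Sum>i\<in>I. k i *\<^sub>R (y i - \<eta>\<^sub>0 - z i *\<^sub>R \<eta>\<^sub>1))
       + norm (\<Sum>i\<in>I. (k i * z i) *\<^sub>R (y i - \<eta>\<^sub>0 - z i *\<^sub>R \<eta>\<^sub>1))) / g"
proof -
  define a where "a = \<theta>\<^sub>0 - \<eta>\<^sub>0"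
  define b where "b = \<theta>\<^sub>1 - \<eta>\<^sub>1"
  define e where "e = (\<lambda>i. y i - \<eta>\<^sub>0 - z i *\<^sub>R \<eta>\<^sub>1)"
  let ?S0 = "\<Sum>i\<in>I. k i *\<^sub>R e i" and ?S1 = "\<Sum>i\<in>I. (k i * z i) *\<^sub>R e i"
  have e: "e i = (y i - \<theta>\<^sub>0 - z i *\<^sub>R \<theta>\<^sub>1) + (a + z i *\<^sub>R b)" for i
    by (simp add: e_def a_def b_def algebra_simps)
  have ne: "(\<Sum>i\<in>I. k i *\<^sub>R (y i - \<theta>\<^sub>0 - z i *\<^sub>R \<theta>\<^sub>1)) = 0"
    by (rule weighted_least_squares_normal_equations(1)[OF k0 min])
  have ne': "(\<Sum>i\<in>I. (k i * z i) *\<^sub>R (y i - \<theta>\<^sub>0 - z i *\<^sub>R \<theta>\<^sub>1)) = 0"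
    by (rule weighted_least_squares_normal_equations(2)[OF k0 min])
  have S0: "?S0 = (\<Sum>i\<in>I. k i *\<^sub>R (a + z i *\<^sub>R b))"
    unfolding e scaleR_add_right[where x = "y _ - _ - _"] sum.distrib ne by simp
  have S1: "?S1 = (\<Sum>i\<in>I. (k i * z i) *\<^sub>R (a + z i *\<^sub>R b))"
    unfolding e scaleR_add_right[where x = "y _ - _ - _"] sum.distrib ne' by simp
  let ?x = "norm (a, b)"
  have x2: "?x\<^sup>2 = (norm a)\<^sup>2 + (norm b)\<^sup>2"
    by (simp add: norm_Pair)
  have xa: "norm a \<le> ?x" "norm b \<le> ?x"
    using norm_fst_le[of a b] norm_snd_le[of b a] by simp_all
  have "g * ?x\<^sup>2 \<le> (\<Sum>i\<in>I. k i * (norm (a + z i *\<^sub>R b))\<^sup>2)"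
    unfolding x2 by (rule gram)
  also have "\<dots> = ?S0 \<bullet> a + ?S1 \<bullet> b"
    unfolding S0 S1 inner_sum_left sum.distrib[symmetric] power2_norm_eq_inner
    by (intro sum.cong refl) (simp add: inner_add_right inner_add_left algebra_simps)
  also have "\<dots> \<le> norm ?S0 * norm a + norm ?S1 * norm b"
    by (intro add_mono norm_cauchy_schwarz)
  also have "\<dots> \<le> norm ?S0 * ?x + norm ?S1 * ?x"
    by (intro add_mono mult_left_mono xa) auto
  finally have "g * ?x * ?x \<le> (norm ?S0 + norm ?S1) * ?x"
    by (simp add: power2_eq_square algebra_simps)
  then have "g * ?x \<le> norm ?S0 + norm ?S1"
  proof (cases "?x = 0")
    case False
    then have "?x > 0" by (metis norm_ge_zero order_le_less)
    with \<open>g * ?x * ?x \<le> _\<close> show ?thesis by (simp only: mult_le_cancel_right)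
  qed (simp only: mult_zero_right add_nonneg_nonneg norm_ge_zero)
  then show ?thesis
    using \<open>g > 0\<close> by (simp add: a_def b_def e_def field_simps)
qed

section \<open>Uniform bounds for kernel sums of the noise\<close>

lemma ln_ge_1:
  assumes "3 \<le> n"
  shows "1 \<le> ln (real n)"
proof -
  have "exp 1 \<le> real n" using exp_le assms by linarith
  then show ?thesis using assms by (subst ln_ge_iff) auto
qed

text \<open>A pointwise substitute for integrating a tail: whatever exceeds the level a is charged
  to exponentials carrying the factor exp (- l * a). With \<bar>x\<bar> = a + y, both y and y^2 are
  bounded by multiples of exp (l * y).\<close>

lemma square_le_exp_bound:
  fixes x a l :: real
  assumes "l > 0" "a \<ge> 0"
  shows "x\<^sup>2 \<le> a\<^sup>2 + (2 * a / l + 2 / l\<^sup>2) * exp (- (l * a)) * (exp (l * x) + exp (- (l * x)))"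
proof (cases "\<bar>x\<bar> \<le> a")
  case True
  then have "\<bar>x\<bar>\<^sup>2 \<le> a\<^sup>2" by (intro power_mono) auto
  moreover have "0 \<le> (2 * a / l + 2 / l\<^sup>2) * exp (- (l * a)) * (exp (l * x) + exp (- (l * x)))"
    using assms by (intro mult_nonneg_nonneg add_nonneg_nonneg) auto
  ultimately show ?thesis by simp
next
  case False
  define y where "y = \<bar>x\<bar> - a"
  have y: "y > 0" "l * y \<ge> 0" using False assms by (simp_all add: y_def)
  have "l * y \<le> exp (l * y)" using exp_ge_add_one_self[of "l * y"] by linarith
  then have y1: "y \<le> exp (l * y) / l" using assms by (simp add: field_simps)
  have "(l * y)\<^sup>2 / 2 \<le> exp (l * y)" using exp_lower_Taylor_quadratic[OF y(2)] y by linarith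
  then have y2: "y\<^sup>2 \<le> 2 / l\<^sup>2 * exp (l * y)" using assms by (simp add: field_simps)
  have "exp (l * y) = exp (l * \<bar>x\<bar>) * exp (- (l * a))"
    by (simp add: y_def exp_add[symmetric] algebra_simps)
  also have "\<dots> \<le> (exp (l * x) + exp (- (l * x))) * exp (- (l * a))"
    by (intro mult_right_mono) (auto simp: abs_if)
  finally have e: "exp (l * y) \<le> exp (- (l * a)) * (exp (l * x) + exp (- (l * x)))"
    by (simp add: mult.commute)
  have "x\<^sup>2 = \<bar>x\<bar>\<^sup>2" by simp
  also have "\<dots> = a\<^sup>2 + 2 * a * y + y\<^sup>2" by (simp add: y_def power2_eq_square algebra_simps)
  also have "\<dots> \<le> a\<^sup>2 + 2 * a * (exp (l * y) / l) + 2 / l\<^sup>2 * exp (l * y)"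
    using y1 y2 assms by (intro add_mono mult_left_mono) auto
  also have "\<dots> = a\<^sup>2 + (2 * a / l + 2 / l\<^sup>2) * exp (l * y)"
    by (simp add: algebra_simps)
  also have "\<dots> \<le> a\<^sup>2 + (2 * a / l + 2 / l\<^sup>2) * (exp (- (l * a)) * (exp (l * x) + exp (- (l * x))))"
    using e assms by (intro add_left_mono mult_left_mono) auto
  finally show ?thesis by (simp add: mult.assoc)
qed

lemma noise_component_mgf:
  fixes s :: real
  assumes "s \<ge> 0"
  obtains D where "D \<ge> 0"
    "\<And>(M :: 'w measure) (\<epsilon> :: nat \<Rightarrow> 'w \<Rightarrow> real ^ 'd) n i k l.
       noise_model s n M \<epsilon> \<Longrightarrow> sub_gaussian_noise s n M \<epsilon> \<Longrightarrow> i \<in> {1..n} \<Longrightarrow> \<bar>l\<bar> \<le> 1 \<Longrightarrow>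
       (\<integral>\<^sup>+\<omega>. ennreal (exp (l * \<epsilon> i \<omega> $ k)) \<partial>M) \<le> ennreal (exp (D * l\<^sup>2))"
proof -
  have basic: "prob_space M" "integrable M (\<lambda>\<omega>. \<epsilon> i \<omega> $ k)" "(\<integral>\<omega>. \<epsilon> i \<omega> $ k \<partial>M) = 0"
    if nm: "noise_model s n M \<epsilon>" and i: "i \<in> {1..n}"
    for M :: "'w measure" and \<epsilon> :: "nat \<Rightarrow> 'w \<Rightarrow> real ^ 'd" and n i k
  proof -
    show "prob_space M" using nm by (simp add: noise_model_def)
    have int: "integrable M (\<epsilon> i)" "(\<integral>\<omega>. \<epsilon> i \<omega> \<partial>M) = 0"
      using nm i by (auto simp: noise_model_def)
    show "integrable M (\<lambda>\<omega>. \<epsilon> i \<omega> $ k)"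
      using integrable_bounded_linear[OF bounded_linear_vec_nth int(1)] .
    show "(\<integral>\<omega>. \<epsilon> i \<omega> $ k \<partial>M) = 0"
      using integral_bounded_linear[OF bounded_linear_vec_nth int(1), of k] int(2) by simp
  qed
  show ?thesis
  proof (cases "s = 0")
    \<comment> \<open>For s = 0 the tail bound is void, as division by zero turns the exponent into
      0. The second moment bound makes the noise vanish almost everywhere, so D = 0 works.\<close>
    case True
    show ?thesis
    proof (rule that[of 0])
      fix M :: "'w measure" and \<epsilon> :: "nat \<Rightarrow> 'w \<Rightarrow> real ^ 'd" and n i k and l :: real
      assume nm: "noise_model s n M \<epsilon>" and i: "i \<in> {1..n}"
      interpret prob_space M using basic(1)[OF nm i] .
      have [measurable]: "\<epsilon> i \<in> borel_measurable M"
        using nm i by (auto simp: noise_model_def intro: borel_measurable_integrable)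
      have "(\<integral>\<^sup>+\<omega>. ennreal ((norm (\<epsilon> i \<omega>))\<^sup>2) \<partial>M) = 0"
        using nm i True by (auto simp: noise_model_def)
      then have "AE \<omega> in M. ennreal ((norm (\<epsilon> i \<omega>))\<^sup>2) = 0"
        by (subst (asm) nn_integral_0_iff_AE) auto
      then have "AE \<omega> in M. ennreal (exp (l * \<epsilon> i \<omega> $ k)) = 1"
        by eventually_elim simp
      then have "(\<integral>\<^sup>+\<omega>. ennreal (exp (l * \<epsilon> i \<omega> $ k)) \<partial>M) = (\<integral>\<^sup>+\<omega>. 1 \<partial>M)"
        by (rule nn_integral_cong_AE)
      then show "(\<integral>\<^sup>+\<omega>. ennreal (exp (l * \<epsilon> i \<omega> $ k)) \<partial>M) \<le> ennreal (exp (0 * l\<^sup>2))"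
        by (simp add: emeasure_space_1)
    qed simp
  next
    case False
    then have "s > 0" using assms by simp
    then obtain D where D: "D \<ge> 0"
      "\<And>(M :: 'w measure) Z. prob_space M \<Longrightarrow> Z \<in> borel_measurable M \<Longrightarrow>
       (\<And>t. t > 0 \<Longrightarrow> measure M {\<omega> \<in> space M. t \<le> \<bar>Z \<omega>\<bar>} \<le> 2 * exp (- t\<^sup>2 / (2 * s\<^sup>2))) \<Longrightarrow>
       (\<integral>\<^sup>+\<omega>. ennreal (exp (2 * \<bar>Z \<omega>\<bar>)) \<partial>M) \<le> ennreal D"
      using sub_gaussian_exp_moment[where 'w = 'w] by blast
    show ?thesis
    proof (rule that[OF D(1)])
      fix M :: "'w measure" and \<epsilon> :: "nat \<Rightarrow> 'w \<Rightarrow> real ^ 'd" and n i k and l :: real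
      assume nm: "noise_model s n M \<epsilon>" and i: "i \<in> {1..n}" and l: "\<bar>l\<bar> \<le> 1"
        and sg: "sub_gaussian_noise s n M \<epsilon>"
      interpret prob_space M using basic(1)[OF nm i] .
      have "(\<integral>\<^sup>+\<omega>. ennreal (exp (2 * \<bar>\<epsilon> i \<omega> $ k\<bar>)) \<partial>M) \<le> ennreal D"
      proof (rule D(2)[OF basic(1)[OF nm i]])
        show "(\<lambda>\<omega>. \<epsilon> i \<omega> $ k) \<in> borel_measurable M" using basic(2)[OF nm i] by auto
        show "prob {\<omega> \<in> space M. t \<le> \<bar>\<epsilon> i \<omega> $ k\<bar>} \<le> 2 * exp (- t\<^sup>2 / (2 * s\<^sup>2))" if "t > 0" for t
        proof -
          have "prob {\<omega> \<in> space M. t \<le> \<bar>\<epsilon> i \<omega> $ k - expectation (\<lambda>\<omega>. \<epsilon> i \<omega> $ k)\<bar>}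
              \<le> 2 * exp (- t\<^sup>2 / (2 * s\<^sup>2))"
            using sg i that unfolding sub_gaussian_noise_def by blast
          then show ?thesis unfolding basic(3)[OF nm i] by simp
        qed
      qed
      then show "(\<integral>\<^sup>+\<omega>. ennreal (exp (l * \<epsilon> i \<omega> $ k)) \<partial>M) \<le> ennreal (exp (D * l\<^sup>2))"
        using basic[OF nm i] D(1) l by (intro mgf_bound) auto
    qed
  qed
qed

text \<open>Chaining is replaced by a union bound over a grid of mesh \<open>h / n\<close>: between grid points
  the weights change by at most \<open>L / n\<close>.  The maximum over the grid is dominated pointwise by a
  sum of exponentials, which keeps the dominating function measurable.\<close>

lemma kernel_sum_noise_bound:
  fixes C L s :: real
  assumes C0: "C \<ge> 0" and L0: "L \<ge> 0" and s0: "s \<ge> 0"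
  obtains A where "A \<ge> 0"
    "\<And>(M :: 'w measure) (\<epsilon> :: nat \<Rightarrow> 'w \<Rightarrow> real ^ 'd) g n \<Delta> h.
       noise_model s n M \<epsilon> \<Longrightarrow> sub_gaussian_noise s n M \<epsilon> \<Longrightarrow>
       (\<And>z. \<bar>g z\<bar> \<le> C) \<Longrightarrow> (\<And>z. 1 < \<bar>z\<bar> \<Longrightarrow> g z = 0) \<Longrightarrow>
       (\<And>z z'. \<bar>g z - g z'\<bar> \<le> L * \<bar>z - z'\<bar>) \<Longrightarrow>
       3 \<le> n \<Longrightarrow> 0 < \<Delta> \<Longrightarrow> \<Delta> \<le> h \<Longrightarrow> C\<^sup>2 * ln (real n) \<le> h / \<Delta> \<Longrightarrow>
       \<exists>R\<in>borel_measurable M. (\<integral>\<^sup>+\<omega>. ennreal (R \<omega>) \<partial>M) \<le> ennreal (A * ((h / \<Delta>) * ln (real n))) \<and>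
         (\<forall>\<omega>. \<forall>t\<in>{0..real n * \<Delta>}.
            (norm (\<Sum>i=1..n. g ((real i * \<Delta> - t) / h) *\<^sub>R \<epsilon> i \<omega>))\<^sup>2 \<le> R \<omega>)"
proof -
  obtain D where D0: "D \<ge> 0" and D:
    "\<And>(M :: 'w measure) (\<epsilon> :: nat \<Rightarrow> 'w \<Rightarrow> real ^ 'd) n i k l.
       noise_model s n M \<epsilon> \<Longrightarrow> sub_gaussian_noise s n M \<epsilon> \<Longrightarrow> i \<in> {1..n} \<Longrightarrow> \<bar>l\<bar> \<le> 1 \<Longrightarrow>
       (\<integral>\<^sup>+\<omega>. ennreal (exp (l * \<epsilon> i \<omega> $ k)) \<partial>M) \<le> ennreal (exp (D * l\<^sup>2))"
    using noise_component_mgf[where 'w = 'w and 'd = 'd, OF s0] by blast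
  \<comment> \<open>exp (- (l * a)) will equal n^(-p). The first summand cancels the moment bound
    n^(3 * D * C^2) of a single sum, the second cancels the at most n^3 grid points of the union
    bound.\<close>
  define p where "p = 3 * D * C\<^sup>2 + 3"
  have p: "p \<ge> 0" using D0 by (simp add: p_def)
  define A where "A = 2 * L\<^sup>2 * s\<^sup>2 + 2 * real CARD('d) * (p\<^sup>2 + 4 * p + 4)"
  show ?thesis
  proof (rule that[of A])
    show "A \<ge> 0" using p by (simp add: A_def)
    fix M :: "'w measure" and \<epsilon> :: "nat \<Rightarrow> 'w \<Rightarrow> real ^ 'd" and g :: "real \<Rightarrow> real"
      and n :: nat and \<Delta> h :: real
    assume nm: "noise_model s n M \<epsilon>" and sg: "sub_gaussian_noise s n M \<epsilon>"
      and gC: "\<And>z. \<bar>g z\<bar> \<le> C" and g1: "\<And>z. 1 < \<bar>z\<bar> \<Longrightarrow> g z = 0"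
      and gL: "\<And>z z'. \<bar>g z - g z'\<bar> \<le> L * \<bar>z - z'\<bar>"
      and n: "3 \<le> n" and \<Delta>: "0 < \<Delta>" "\<Delta> \<le> h" and Cln: "C\<^sup>2 * ln (real n) \<le> h / \<Delta>"
    interpret prob_space M using nm by (simp add: noise_model_def)
    have int: "integrable M (\<epsilon> i)" if "i \<in> {1..n}" for i
      using nm that by (auto simp: noise_model_def)
    have [measurable]: "(\<lambda>\<omega>. \<epsilon> i \<omega> $ k) \<in> borel_measurable M" if "i \<in> {1..n}" for i k
      using integrable_bounded_linear[OF bounded_linear_vec_nth int[OF that]] by auto
    have [measurable]: "\<epsilon> i \<in> borel_measurable M" if "i \<in> {1..n}" for i
      using int[OF that] by auto
    have h: "h > 0" using \<Delta> by simp
    define N where "N = h / \<Delta>"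
    have N1: "N \<ge> 1" using \<Delta> by (simp add: N_def)
    have ln1: "ln (real n) \<ge> 1" using n by (rule ln_ge_1)
    \<comment> \<open>This choice makes the moment exponent, of order l^2 * N, and also l * a for a
      of order sqrt (N * ln n), constant multiples of ln n. The hypothesis
      \<open>C\<^sup>2 * ln (real n) \<le> h / \<Delta>\<close> means l * C \<le> 1, so all
      arguments stay in the range of the moment bound.\<close>
    define l where "l = sqrt (ln (real n) / N)"
    have l: "l > 0" "l\<^sup>2 = ln (real n) / N" using ln1 N1 by (auto simp: l_def)
    define a where "a = p * sqrt (N * ln (real n))"
    have a0: "a \<ge> 0" using p N1 ln1 by (simp add: a_def)
    have a2: "a\<^sup>2 = p\<^sup>2 * (N * ln (real n))" using N1 ln1 by (simp add: a_def power_mult_distrib)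
    have sq: "sqrt (N * ln (real n)) = l * N"
    proof (rule real_sqrt_unique)
      show "(l * N)\<^sup>2 = N * ln (real n)"
        unfolding power_mult_distrib l(2) using N1 by (simp add: power2_eq_square)
    qed (use l N1 in auto)
    have la: "l * a = p * ln (real n)"
      using l(2) N1 by (simp add: a_def sq power2_eq_square field_simps)
    have al: "a / l = p * N" using l(1) by (simp add: a_def sq)
    define b where "b = (2 * a / l + 2 / l\<^sup>2) * exp (- (l * a))"
    have b0: "b \<ge> 0" using l(1) a0 by (simp add: b_def)
    define G where "G = nat \<lfloor>real n * \<Delta> * real n / h\<rfloor>"
    define \<tau> where "\<tau> = (\<lambda>j::nat. real j * h / real n)"
    define wt where "wt = (\<lambda>j i. g ((real i * \<Delta> - \<tau> j) / h))"
    define X where "X = (\<lambda>j k \<omega>. \<Sum>i=1..n. wt j i * \<epsilon> i \<omega> $ k)"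
    have [measurable]: "X j k \<in> borel_measurable M" for j k
      unfolding X_def by measurable
    \<comment> \<open>The three parts pay for moving t to a grid point, for the level a, and for the
      excess over a at any grid point and in any component. The factors 2 come from splitting the
      square of a sum of two norms.\<close>
    define R where "R = (\<lambda>\<omega>. (\<Sum>i=1..n. 2 * L\<^sup>2 / real n * (norm (\<epsilon> i \<omega>))\<^sup>2)
        + (2 * real CARD('d) * a\<^sup>2
        + (\<Sum>k\<in>(UNIV :: 'd set). \<Sum>j\<le>G. 2 * b * exp (l * X j k \<omega>) + 2 * b * exp (- l * X j k \<omega>))))"
    have [measurable]: "R \<in> borel_measurable M"
      unfolding R_def by measurable
    have wt2: "(\<Sum>i=1..n. (wt j i)\<^sup>2) \<le> 3 * C\<^sup>2 * N" for j
    proof -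
      let ?W = "{i \<in> {1..n}. \<bar>(real i * \<Delta> - \<tau> j) / h\<bar> \<le> 1}"
      have "(\<Sum>i=1..n. (wt j i)\<^sup>2) = (\<Sum>i\<in>?W. (wt j i)\<^sup>2)"
      proof (intro sum.mono_neutral_right ballI)
        fix i assume "i \<in> {1..n} - ?W"
        then have "1 < \<bar>(real i * \<Delta> - \<tau> j) / h\<bar>" by (simp only: Diff_iff mem_Collect_eq) linarith
        then show "(wt j i)\<^sup>2 = 0" by (simp only: wt_def g1) simp
      qed auto
      also have "\<dots> \<le> (\<Sum>i\<in>?W. C\<^sup>2)"
        by (intro sum_mono) (metis wt_def gC abs_ge_zero power2_abs power_mono)
      also have "\<dots> = real (card ?W) * C\<^sup>2" by simp
      also have "\<dots> \<le> (2 * (h / \<Delta>) + 1) * C\<^sup>2"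
        using \<Delta> h by (intro mult_right_mono card_window_le) auto
      also have "\<dots> \<le> (3 * N) * C\<^sup>2"
        using N1 by (intro mult_right_mono) (auto simp: N_def)
      finally show ?thesis by (simp add: algebra_simps)
    qed
    have mgf: "(\<integral>\<^sup>+\<omega>. ennreal (exp (e * X j k \<omega>)) \<partial>M) \<le> ennreal (exp (3 * D * C\<^sup>2 * ln (real n)))"
      if e: "\<bar>e\<bar> = l" for e j k
    proof -
      have el: "e\<^sup>2 = l\<^sup>2" using e by (metis power2_abs)
      have "(l * C)\<^sup>2 \<le> 1\<^sup>2"
        unfolding power_mult_distrib l(2) using Cln[folded N_def] N1 by (simp add: field_simps)
      then have lC: "l * C \<le> 1" by (rule power2_le_imp_le) simp
      have "indep_vars (\<lambda>_. borel) \<epsilon> {1..n}" using nm by (simp add: noise_model_def)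
      then have "indep_vars (\<lambda>_. borel) (\<lambda>i \<omega>. \<epsilon> i \<omega> $ k) {1..n}"
        by (rule indep_vars_compose2)
           (auto intro!: borel_measurable_continuous_onI linear_continuous_on bounded_linear_vec_nth)
      then have "(\<integral>\<^sup>+\<omega>. ennreal (exp (\<Sum>i=1..n. (e * wt j i) * \<epsilon> i \<omega> $ k)) \<partial>M)
          \<le> ennreal (exp (D * (\<Sum>i=1..n. (e * wt j i)\<^sup>2)))"
      proof (rule mgf_weighted_sum_bound[rotated])
        fix i :: nat assume i: "i \<in> {1..n}"
        show "\<bar>e * wt j i\<bar> \<le> 1"
        proof -
          have "\<bar>e * wt j i\<bar> \<le> l * C"
            unfolding abs_mult e using l(1) gC by (intro mult_left_mono) (auto simp: wt_def)
          then show ?thesis using lC by simp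
        qed
        show "(\<integral>\<^sup>+\<omega>. ennreal (exp (x * \<epsilon> i \<omega> $ k)) \<partial>M) \<le> ennreal (exp (D * x\<^sup>2))" if "\<bar>x\<bar> \<le> 1" for x
          by (rule D[OF nm sg i that])
      qed simp
      also have "(\<Sum>i=1..n. (e * wt j i)\<^sup>2) = l\<^sup>2 * (\<Sum>i=1..n. (wt j i)\<^sup>2)"
        by (simp add: power_mult_distrib el sum_distrib_left)
      also have "ennreal (exp (D * (l\<^sup>2 * (\<Sum>i=1..n. (wt j i)\<^sup>2))))
          \<le> ennreal (exp (D * (l\<^sup>2 * (3 * C\<^sup>2 * N))))"
        using wt2 D0 by (intro ennreal_leI, subst exp_le_cancel_iff, intro mult_left_mono) auto
      also have "D * (l\<^sup>2 * (3 * C\<^sup>2 * N)) = 3 * D * C\<^sup>2 * ln (real n)"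
        using N1 by (simp add: l(2))
      finally show ?thesis by (simp add: X_def sum_distrib_left mult.assoc)
    qed
    \<comment> \<open>As \<Delta> \<le> h, the grid has at most n^2 + 1 points; the crude bound n^3
      affects only the constant in front of ln n.\<close>
    have G: "real G + 1 \<le> exp (3 * ln (real n))"
    proof -
      have "real n * real n * (\<Delta> / h) \<le> real n * real n * 1"
        using \<Delta> h by (intro mult_left_mono) auto
      then have "real n * \<Delta> * real n / h \<le> real n * real n * 1"
        by (simp add: ac_simps)
      moreover have "0 \<le> real n * \<Delta> * real n / h" using \<Delta> h by simp
      ultimately have "real G \<le> real n * real n" unfolding G_def by linarith
      then have "real G + 1 \<le> real n * real n + 1" by simp
      also have "\<dots> \<le> real n * real n * 2"
      proof -
        have "1 * 1 \<le> real n * real n" using n by (intro mult_mono) auto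
        then show ?thesis by linarith
      qed
      also have "\<dots> \<le> real n * real n * real n" using n by (intro mult_left_mono) auto
      also have "\<dots> = exp (3 * ln (real n))"
        using n by (simp add: exp_of_nat_mult[of 3 "ln (real n)", simplified] power3_eq_cube)
      finally show ?thesis .
    qed
    have "(\<integral>\<^sup>+\<omega>. ennreal (R \<omega>) \<partial>M)
        = (\<integral>\<^sup>+\<omega>. (\<Sum>i=1..n. ennreal (2 * L\<^sup>2 / real n) * ennreal ((norm (\<epsilon> i \<omega>))\<^sup>2))
        + (ennreal (2 * real CARD('d) * a\<^sup>2)
        + (\<Sum>k\<in>(UNIV :: 'd set). \<Sum>j\<le>G. ennreal (2 * b) * ennreal (exp (l * X j k \<omega>))
             + ennreal (2 * b) * ennreal (exp (- l * X j k \<omega>)))) \<partial>M)"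
      using b0 by (intro nn_integral_cong)
        (simp add: R_def ennreal_mult[symmetric] sum_nonneg ennreal_plus[symmetric] sum_ennreal
          del: ennreal_plus)
    also have "\<dots> = (\<integral>\<^sup>+\<omega>. (\<Sum>i=1..n. ennreal (2 * L\<^sup>2 / real n) * ennreal ((norm (\<epsilon> i \<omega>))\<^sup>2)) \<partial>M)
        + (\<integral>\<^sup>+\<omega>. (ennreal (2 * real CARD('d) * a\<^sup>2)
        + (\<Sum>k\<in>(UNIV :: 'd set). \<Sum>j\<le>G. ennreal (2 * b) * ennreal (exp (l * X j k \<omega>))
             + ennreal (2 * b) * ennreal (exp (- l * X j k \<omega>)))) \<partial>M)"
      by (rule nn_integral_add) measurable
    also have "(\<integral>\<^sup>+\<omega>. (\<Sum>i=1..n. ennreal (2 * L\<^sup>2 / real n) * ennreal ((norm (\<epsilon> i \<omega>))\<^sup>2)) \<partial>M)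
        = (\<Sum>i=1..n. \<integral>\<^sup>+\<omega>. ennreal (2 * L\<^sup>2 / real n) * ennreal ((norm (\<epsilon> i \<omega>))\<^sup>2) \<partial>M)"
      by (rule nn_integral_sum) measurable
    also have "\<dots> = (\<Sum>i=1..n. ennreal (2 * L\<^sup>2 / real n) * (\<integral>\<^sup>+\<omega>. ennreal ((norm (\<epsilon> i \<omega>))\<^sup>2) \<partial>M))"
      by (intro sum.cong refl nn_integral_cmult) measurable
    also have "(\<integral>\<^sup>+\<omega>. (ennreal (2 * real CARD('d) * a\<^sup>2)
        + (\<Sum>k\<in>(UNIV :: 'd set). \<Sum>j\<le>G. ennreal (2 * b) * ennreal (exp (l * X j k \<omega>))
             + ennreal (2 * b) * ennreal (exp (- l * X j k \<omega>)))) \<partial>M)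
        = ennreal (2 * real CARD('d) * a\<^sup>2)
        + (\<Sum>k\<in>(UNIV :: 'd set). \<Sum>j\<le>G. ennreal (2 * b) * (\<integral>\<^sup>+\<omega>. ennreal (exp (l * X j k \<omega>)) \<partial>M)
             + ennreal (2 * b) * (\<integral>\<^sup>+\<omega>. ennreal (exp (- l * X j k \<omega>)) \<partial>M))"
      by (simp add: nn_integral_add nn_integral_sum nn_integral_cmult emeasure_space_1)
    finally have "(\<integral>\<^sup>+\<omega>. ennreal (R \<omega>) \<partial>M)
        = (\<Sum>i=1..n. ennreal (2 * L\<^sup>2 / real n) * (\<integral>\<^sup>+\<omega>. ennreal ((norm (\<epsilon> i \<omega>))\<^sup>2) \<partial>M))
        + (ennreal (2 * real CARD('d) * a\<^sup>2)
        + (\<Sum>k\<in>(UNIV :: 'd set). \<Sum>j\<le>G. ennreal (2 * b) * (\<integral>\<^sup>+\<omega>. ennreal (exp (l * X j k \<omega>)) \<partial>M)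
             + ennreal (2 * b) * (\<integral>\<^sup>+\<omega>. ennreal (exp (- l * X j k \<omega>)) \<partial>M)))" .
    also have "\<dots> \<le> (\<Sum>i=1..n. ennreal (2 * L\<^sup>2 / real n) * ennreal (s\<^sup>2))
        + (ennreal (2 * real CARD('d) * a\<^sup>2)
        + (\<Sum>k\<in>(UNIV :: 'd set). \<Sum>j\<le>G. ennreal (2 * b) * ennreal (exp (3 * D * C\<^sup>2 * ln (real n)))
             + ennreal (2 * b) * ennreal (exp (3 * D * C\<^sup>2 * ln (real n)))))"
      using nm l(1) by (intro add_mono sum_mono mult_left_mono mgf order_refl) (auto simp: noise_model_def)
    also have "\<dots> = ennreal (2 * L\<^sup>2 * s\<^sup>2 + (2 * real CARD('d) * a\<^sup>2
        + real CARD('d) * ((real G + 1) * (4 * b * exp (3 * D * C\<^sup>2 * ln (real n))))))"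
      using b0 n by (simp add: ennreal_mult[symmetric] ennreal_plus[symmetric] ennreal_of_nat_eq_real_of_nat
          del: ennreal_plus)
    also have "\<dots> \<le> ennreal (A * (N * ln (real n)))"
    proof (rule ennreal_leI)
      have "(real G + 1) * (4 * b * exp (3 * D * C\<^sup>2 * ln (real n)))
          \<le> exp (3 * ln (real n)) * (4 * b * exp (3 * D * C\<^sup>2 * ln (real n)))"
        using G b0 by (intro mult_right_mono) auto
      also have "\<dots> = 4 * (2 * a / l + 2 / l\<^sup>2)
          * (exp (3 * ln (real n)) * exp (3 * D * C\<^sup>2 * ln (real n)) * exp (- (l * a)))"
        by (simp add: b_def)
      also have "exp (3 * ln (real n)) * exp (3 * D * C\<^sup>2 * ln (real n)) * exp (- (l * a)) = 1"
        unfolding exp_add[symmetric] la by (simp add: p_def algebra_simps)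
      also have "2 * a / l + 2 / l\<^sup>2 = 2 * p * N + 2 * N / ln (real n)"
        using al by (simp add: l(2))
      also have "4 * (2 * p * N + 2 * N / ln (real n)) * 1
          \<le> 4 * (2 * p * (N * ln (real n)) + 2 * (N * ln (real n)))"
      proof -
        have "N * 1 \<le> N * ln (real n)" using ln1 N1 by (intro mult_left_mono) auto
        moreover have "p * (N * 1) \<le> p * (N * ln (real n))"
          by (rule mult_left_mono[OF calculation p])
        moreover have "N / ln (real n) \<le> N / 1" using ln1 N1 by (intro divide_left_mono) auto
        ultimately show ?thesis by simp
      qed
      finally have *: "(real G + 1) * (4 * b * exp (3 * D * C\<^sup>2 * ln (real n)))
          \<le> (8 * p + 8) * (N * ln (real n))" by (simp add: algebra_simps)
      have "1 * 1 \<le> N * ln (real n)" using N1 ln1 by (intro mult_mono) auto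
      then have "2 * L\<^sup>2 * s\<^sup>2 * 1 \<le> 2 * L\<^sup>2 * s\<^sup>2 * (N * ln (real n))"
        by (intro mult_left_mono) auto
      moreover have "real CARD('d) * ((real G + 1) * (4 * b * exp (3 * D * C\<^sup>2 * ln (real n))))
          \<le> real CARD('d) * ((8 * p + 8) * (N * ln (real n)))"
        using * by (intro mult_left_mono) auto
      ultimately show "2 * L\<^sup>2 * s\<^sup>2 + (2 * real CARD('d) * a\<^sup>2
        + real CARD('d) * ((real G + 1) * (4 * b * exp (3 * D * C\<^sup>2 * ln (real n)))))
        \<le> A * (N * ln (real n))"
        by (simp add: A_def a2 algebra_simps)
    qed
    finally have ER: "(\<integral>\<^sup>+\<omega>. ennreal (R \<omega>) \<partial>M) \<le> ennreal (A * ((h / \<Delta>) * ln (real n)))"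
      by (simp add: N_def)
    have "(norm (\<Sum>i=1..n. g ((real i * \<Delta> - t) / h) *\<^sub>R \<epsilon> i \<omega>))\<^sup>2 \<le> R \<omega>"
      if t: "t \<in> {0..real n * \<Delta>}" for t \<omega>
    proof -
      define j where "j = nat \<lfloor>t * real n / h\<rfloor>"
      have tn: "0 \<le> t * real n / h" using t h by simp
      have jG: "j \<le> G"
        unfolding j_def G_def using t h by (intro nat_mono floor_mono divide_right_mono mult_right_mono) auto
      have "real j \<le> t * real n / h" "t * real n / h \<le> real j + 1"
        using tn unfolding j_def by linarith+
      then have "\<bar>t * real n / h - real j\<bar> * (h / real n) \<le> 1 * (h / real n)"
        using h by (intro mult_right_mono) auto
      moreover have "t - \<tau> j = (t * real n / h - real j) * (h / real n)"
        using h n by (simp add: \<tau>_def field_simps)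
      ultimately have "\<bar>t - \<tau> j\<bar> \<le> h / real n"
        using h by (simp add: abs_mult)
      then have dz: "\<bar>t - \<tau> j\<bar> / h \<le> 1 / real n" using h by (simp add: field_simps)
      let ?x = "\<Sum>i=1..n. wt j i *\<^sub>R \<epsilon> i \<omega>"
      let ?y = "\<Sum>i=1..n. (g ((real i * \<Delta> - t) / h) - wt j i) *\<^sub>R \<epsilon> i \<omega>"
      have "norm ?y \<le> (\<Sum>i=1..n. norm ((g ((real i * \<Delta> - t) / h) - wt j i) *\<^sub>R \<epsilon> i \<omega>))"
        by (rule norm_sum)
      also have "\<dots> \<le> (\<Sum>i=1..n. L * (1 / real n) * norm (\<epsilon> i \<omega>))"
      proof (rule sum_mono)
        fix i
        have "\<bar>g ((real i * \<Delta> - t) / h) - wt j i\<bar> \<le> L * \<bar>(real i * \<Delta> - t) / h - (real i * \<Delta> - \<tau> j) / h\<bar>"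
          unfolding wt_def by (rule gL)
        also have "(real i * \<Delta> - t) / h - (real i * \<Delta> - \<tau> j) / h = - ((t - \<tau> j) / h)"
          by (simp add: diff_divide_distrib)
        also have "L * \<bar>- ((t - \<tau> j) / h)\<bar> \<le> L * (1 / real n)"
          using dz h L0 by (intro mult_left_mono) (auto simp: abs_divide)
        finally show "norm ((g ((real i * \<Delta> - t) / h) - wt j i) *\<^sub>R \<epsilon> i \<omega>) \<le> L * (1 / real n) * norm (\<epsilon> i \<omega>)"
          unfolding norm_scaleR by (rule mult_right_mono) simp
      qed
      \<comment> \<open>By Cauchy-Schwarz the n increments of size L / n cost L^2 / n times the sum
        of the squared noise norms. Its expectation is at most L^2 * s^2, whatever N is; this is
        what the mesh h / n is for.\<close>
      finally have "(norm ?y)\<^sup>2 \<le> (\<Sum>i=1..n. L * (1 / real n) * norm (\<epsilon> i \<omega>))\<^sup>2"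
        by (intro power_mono) auto
      also have "\<dots> \<le> (\<Sum>i=1..n. (L * (1 / real n) * norm (\<epsilon> i \<omega>))\<^sup>2) * real n"
        using sum_squared_le_sum_of_squares[of "\<lambda>i. L * (1 / real n) * norm (\<epsilon> i \<omega>)" "{1..n}"] n
        by simp
      also have "\<dots> = (\<Sum>i=1..n. L\<^sup>2 / real n * (norm (\<epsilon> i \<omega>))\<^sup>2)"
        unfolding sum_distrib_right using n
        by (intro sum.cong refl) (simp add: power_mult_distrib power2_eq_square)
      finally have "2 * (norm ?y)\<^sup>2 \<le> 2 * (\<Sum>i=1..n. L\<^sup>2 / real n * (norm (\<epsilon> i \<omega>))\<^sup>2)"
        by (rule mult_left_mono) simp
      also have "\<dots> = (\<Sum>i=1..n. 2 * L\<^sup>2 / real n * (norm (\<epsilon> i \<omega>))\<^sup>2)"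
        unfolding sum_distrib_left by (intro sum.cong refl) simp
      finally have y: "2 * (norm ?y)\<^sup>2 \<le> (\<Sum>i=1..n. 2 * L\<^sup>2 / real n * (norm (\<epsilon> i \<omega>))\<^sup>2)" .
      have "(norm ?x)\<^sup>2 = (\<Sum>k\<in>UNIV. (X j k \<omega>)\<^sup>2)"
        by (simp add: norm_vec_def L2_set_def sum_nonneg X_def)
      also have "\<dots> \<le> (\<Sum>k\<in>UNIV. a\<^sup>2 + (\<Sum>j\<le>G. b * exp (l * X j k \<omega>) + b * exp (- l * X j k \<omega>)))"
      proof (rule sum_mono)
        fix k
        have "(X j k \<omega>)\<^sup>2 \<le> a\<^sup>2 + b * (exp (l * X j k \<omega>) + exp (- (l * X j k \<omega>)))"
          unfolding b_def by (rule square_le_exp_bound[OF l(1) a0])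
        also have "b * (exp (l * X j k \<omega>) + exp (- (l * X j k \<omega>)))
            = (\<Sum>j\<in>{j}. b * exp (l * X j k \<omega>) + b * exp (- l * X j k \<omega>))"
          by (simp add: algebra_simps)
        also have "\<dots> \<le> (\<Sum>j\<le>G. b * exp (l * X j k \<omega>) + b * exp (- l * X j k \<omega>))"
          using jG b0 by (intro sum_mono2) auto
        finally show "(X j k \<omega>)\<^sup>2 \<le> a\<^sup>2 + (\<Sum>j\<le>G. b * exp (l * X j k \<omega>) + b * exp (- l * X j k \<omega>))"
          by simp
      qed
      finally have "2 * (norm ?x)\<^sup>2
          \<le> 2 * (\<Sum>k\<in>(UNIV :: 'd set). a\<^sup>2 + (\<Sum>j\<le>G. b * exp (l * X j k \<omega>) + b * exp (- l * X j k \<omega>)))"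
        by (rule mult_left_mono) simp
      also have "\<dots> = (\<Sum>k\<in>(UNIV :: 'd set). 2 * a\<^sup>2
          + (\<Sum>j\<le>G. 2 * b * exp (l * X j k \<omega>) + 2 * b * exp (- l * X j k \<omega>)))"
        unfolding sum_distrib_left distrib_left mult.assoc ..
      also have "\<dots> = 2 * real CARD('d) * a\<^sup>2
        + (\<Sum>k\<in>(UNIV :: 'd set). \<Sum>j\<le>G. 2 * b * exp (l * X j k \<omega>) + 2 * b * exp (- l * X j k \<omega>))"
        unfolding sum.distrib[of "\<lambda>k. 2 * a\<^sup>2"] by simp
      finally have x: "2 * (norm ?x)\<^sup>2 \<le> 2 * real CARD('d) * a\<^sup>2
        + (\<Sum>k\<in>(UNIV :: 'd set). \<Sum>j\<le>G. 2 * b * exp (l * X j k \<omega>) + 2 * b * exp (- l * X j k \<omega>))" .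
      have "(\<Sum>i=1..n. g ((real i * \<Delta> - t) / h) *\<^sub>R \<epsilon> i \<omega>) = ?x + ?y"
        by (simp add: sum.distrib[symmetric] scaleR_add_left[symmetric])
      then have "(norm (\<Sum>i=1..n. g ((real i * \<Delta> - t) / h) *\<^sub>R \<epsilon> i \<omega>))\<^sup>2 \<le> (norm ?x + norm ?y)\<^sup>2"
        by (simp add: norm_triangle_ineq power_mono)
      also have "\<dots> \<le> 2 * (norm ?x)\<^sup>2 + 2 * (norm ?y)\<^sup>2"
        using sum_squares_bound[of "norm ?x" "norm ?y"] by (simp add: power2_sum)
      also have "\<dots> \<le> R \<omega>" using x y by (simp add: R_def)
      finally show ?thesis .
    qed
    with ER show "\<exists>R\<in>borel_measurable M.
        (\<integral>\<^sup>+\<omega>. ennreal (R \<omega>) \<partial>M) \<le> ennreal (A * ((h / \<Delta>) * ln (real n))) \<and>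
         (\<forall>\<omega>. \<forall>t\<in>{0..real n * \<Delta>}.
            (norm (\<Sum>i=1..n. g ((real i * \<Delta> - t) / h) *\<^sub>R \<epsilon> i \<omega>))\<^sup>2 \<le> R \<omega>)"
      by (intro bexI[of _ R]) auto
  qed
qed

section \<open>Deterministic error bounds\<close>

lemma C1_class_norm_le: "f \<in> C1_class L0 L1 \<Longrightarrow> norm (f x) \<le> L0"
  by (simp add: C1_class_def)

lemma C1_class_lipschitz:
  fixes f :: "real ^ 'd \<Rightarrow> real ^ 'd"
  assumes "f \<in> C1_class L0 L1"
  shows "norm (f x - f y) \<le> L1 * norm (x - y)"
proof -
  obtain Df :: "real ^ 'd \<Rightarrow> ((real ^ 'd) \<Rightarrow>\<^sub>L (real ^ 'd))" where
    Df: "\<And>x. (f has_derivative blinfun_apply (Df x)) (at x)" "\<And>x. norm (Df x) \<le> L1"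
    using assms by (auto simp: C1_class_def)
  show ?thesis
    using Df by (intro differentiable_bound[OF convex_UNIV, of f "\<lambda>x. blinfun_apply (Df x)"])
      (auto simp: norm_blinfun.rep_eq)
qed

lemma flow_line_lipschitz:
  fixes f :: "real ^ 'd \<Rightarrow> real ^ 'd"
  assumes "f \<in> C1_class L0 L1" "is_flow_line f x u"
  shows "norm (u s - u t) \<le> L0 * \<bar>s - t\<bar>"
proof -
  have "norm (u s - u t) \<le> L0 * norm (s - t)"
  proof (rule differentiable_bound[OF convex_UNIV, of u "\<lambda>x y. y *\<^sub>R f (u x)"])
    fix x :: real
    show "(u has_derivative (\<lambda>y. y *\<^sub>R f (u x))) (at x)"
      using assms(2) by (simp add: is_flow_line_def has_vector_derivative_def)
    show "onorm (\<lambda>y. y *\<^sub>R f (u x)) \<le> L0"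
      using C1_class_norm_le[OF assms(1), of "u x"]
      by (intro onorm_le) (simp add: mult.commute[of L0] mult_left_mono)
  qed auto
  then show ?thesis by simp
qed

text \<open>The derivative f (u r) of the flow line is Lipschitz with constant L0 * L1, so the mean
  value inequality applies to u minus its tangent line. Bounding the derivative by its largest value
  on the segment gives the constant without the factor 1 / 2.\<close>

lemma flow_line_taylor:
  fixes f :: "real ^ 'd \<Rightarrow> real ^ 'd"
  assumes f: "f \<in> C1_class L0 L1" and u: "is_flow_line f x u" and "L1 \<ge> 0"
  shows "norm (u s - u t - (s - t) *\<^sub>R f (u t)) \<le> L0 * L1 * (s - t)\<^sup>2"
proof -
  define v where "v = (\<lambda>r. u r - (r - t) *\<^sub>R f (u t))"
  have L0: "L0 \<ge> 0" using C1_class_norm_le[OF f, of 0] norm_ge_zero order_trans by blast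
  have "norm (v s - v t) \<le> (L0 * L1 * \<bar>s - t\<bar>) * norm (s - t)"
  proof (rule differentiable_bound[of "closed_segment t s" v "\<lambda>r y. y *\<^sub>R (f (u r) - f (u t))"])
    fix r assume r: "r \<in> closed_segment t s"
    have "(u has_derivative (\<lambda>y. y *\<^sub>R f (u r))) (at r within closed_segment t s)"
      using u by (auto simp: is_flow_line_def has_vector_derivative_def intro: has_derivative_at_withinI)
    then show "(v has_derivative (\<lambda>y. y *\<^sub>R (f (u r) - f (u t)))) (at r within closed_segment t s)"
      unfolding v_def by (auto intro!: derivative_eq_intros simp: scaleR_diff_right)
    have "\<bar>r - t\<bar> \<le> \<bar>s - t\<bar>" using segment_bound1[OF r] by simp
    then have "L1 * (L0 * \<bar>r - t\<bar>) \<le> L1 * (L0 * \<bar>s - t\<bar>)"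
      using assms(3) L0 by (intro mult_left_mono) auto
    moreover have "L1 * norm (u r - u t) \<le> L1 * (L0 * \<bar>r - t\<bar>)"
      using assms(3) by (intro mult_left_mono flow_line_lipschitz[OF f u])
    ultimately have "norm (f (u r) - f (u t)) \<le> L0 * L1 * \<bar>s - t\<bar>"
      using C1_class_lipschitz[OF f, of "u r" "u t"] by (simp add: algebra_simps)
    then show "onorm (\<lambda>y. y *\<^sub>R (f (u r) - f (u t))) \<le> L0 * L1 * \<bar>s - t\<bar>"
      by (intro onorm_le) (simp add: mult.commute[of "L0 * L1 * _"] mult_left_mono)
  qed auto
  then show ?thesis by (simp add: v_def power2_eq_square abs_mult_self_eq algebra_simps)
qed

lemma local_linear_fit_minimizes:
  assumes "local_linear_fit K h n \<Delta> Y T \<theta>\<^sub>0 \<theta>\<^sub>1" "t \<in> {0..T}" "h > 0"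
  shows "(\<Sum>i=1..n. (norm (Y i - \<theta>\<^sub>0 t - ((real i * \<Delta> - t) / h) *\<^sub>R \<theta>\<^sub>1 t))\<^sup>2 * K \<bar>(real i * \<Delta> - t) / h\<bar>)
    \<le> (\<Sum>i=1..n. (norm (Y i - a - ((real i * \<Delta> - t) / h) *\<^sub>R b))\<^sup>2 * K \<bar>(real i * \<Delta> - t) / h\<bar>)"
proof -
  have "is_arg_min (local_linear_loss K h n \<Delta> Y t) (\<lambda>_. True) (\<theta>\<^sub>0 t, \<theta>\<^sub>1 t)"
    using assms by (simp add: local_linear_fit_def)
  then have "local_linear_loss K h n \<Delta> Y t (\<theta>\<^sub>0 t, \<theta>\<^sub>1 t) \<le> local_linear_loss K h n \<Delta> Y t (a, b)"
    by (simp add: is_arg_min_linorder)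
  then show ?thesis
    using assms(3) by (simp add: local_linear_loss_def abs_divide)
qed

context local_kernel
begin

lemma gram_const_pos: "gram_const > 0"
  using c_pos w_pos by (simp add: gram_const_def add_pos_nonneg)

lemma continuous_on_kernel: "continuous_on UNIV (\<lambda>z. K \<bar>z\<bar>)"
proof -
  have "L-lipschitz_on UNIV (\<lambda>z. K \<bar>z\<bar>)"
    using K_lipschitz L_nonneg by (intro lipschitz_onI) (auto simp: dist_real_def)
  then show ?thesis by (rule lipschitz_on_continuous_on)
qed

lemma fit_error:
  fixes Y :: "nat \<Rightarrow> real ^ 'd"
  assumes "local_linear_fit K h n \<Delta> Y (real n * \<Delta>) \<theta>\<^sub>0 \<theta>\<^sub>1"
    and "\<Delta> > 0" "h > 0" "2 * h \<le> real n * \<Delta>" "2 \<le> w * (h / \<Delta>)" "t \<in> {0..real n * \<Delta>}"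
  shows "norm (\<theta>\<^sub>0 t - \<eta>\<^sub>0, \<theta>\<^sub>1 t - \<eta>\<^sub>1)
    \<le> (norm (\<Sum>i=1..n. K \<bar>(real i * \<Delta> - t) / h\<bar> *\<^sub>R
              (Y i - \<eta>\<^sub>0 - ((real i * \<Delta> - t) / h) *\<^sub>R \<eta>\<^sub>1))
       + norm (\<Sum>i=1..n. (K \<bar>(real i * \<Delta> - t) / h\<bar> * ((real i * \<Delta> - t) / h)) *\<^sub>R
              (Y i - \<eta>\<^sub>0 - ((real i * \<Delta> - t) / h) *\<^sub>R \<eta>\<^sub>1))) / (gram_const * (h / \<Delta>))"
proof (rule weighted_least_squares_error[where y = Y])
  show "gram_const * (h / \<Delta>) > 0" using gram_const_pos assms by simp
  show "0 \<le> K \<bar>(real i * \<Delta> - t) / h\<bar>" for i by (rule K_nonneg)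
  show "gram_const * (h / \<Delta>) * ((norm a)\<^sup>2 + (norm b)\<^sup>2) \<le> (\<Sum>i=1..n. K \<bar>(real i * \<Delta> - t) / h\<bar>
      * (norm (a + ((real i * \<Delta> - t) / h) *\<^sub>R b))\<^sup>2)" for a b :: "real ^ 'd"
    by (rule gram_lower_bound) (use assms in auto)
qed (rule local_linear_fit_minimizes[OF assms(1,6,3)])

text \<open>\<open>nearest_time_selector\<close> constrains continuous curves only, so this opens
  the way to the nearest time. Comparing the fit at t' with the fixed pair fitted at t bounds their
  distance by F t'. The function F is continuous, since its comparison pair is fixed, and vanishes
  at t by the normal equations.\<close>

lemma fit_continuous:
  fixes Y :: "nat \<Rightarrow> real ^ 'd"
  assumes fit: "local_linear_fit K h n \<Delta> Y (real n * \<Delta>) \<theta>\<^sub>0 \<theta>\<^sub>1"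
    and "\<Delta> > 0" "h > 0" "2 * h \<le> real n * \<Delta>" "2 \<le> w * (h / \<Delta>)"
  shows "continuous_on {0..real n * \<Delta>} \<theta>\<^sub>0"
  unfolding continuous_on_def
proof
  fix t assume t: "t \<in> {0..real n * \<Delta>}"
  define F where "F = (\<lambda>t'. (norm (\<Sum>i=1..n. K \<bar>(real i * \<Delta> - t') / h\<bar> *\<^sub>R
              (Y i - \<theta>\<^sub>0 t - ((real i * \<Delta> - t') / h) *\<^sub>R \<theta>\<^sub>1 t))
       + norm (\<Sum>i=1..n. (K \<bar>(real i * \<Delta> - t') / h\<bar> * ((real i * \<Delta> - t') / h)) *\<^sub>R
              (Y i - \<theta>\<^sub>0 t - ((real i * \<Delta> - t') / h) *\<^sub>R \<theta>\<^sub>1 t))) / (gram_const * (h / \<Delta>)))"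
  have "continuous_on UNIV F"
    unfolding F_def using assms gram_const_pos
    by (intro continuous_intros continuous_on_compose2[OF continuous_on_kernel]) auto
  then have "(F \<longlongrightarrow> F t) (at t within {0..real n * \<Delta>})"
    by (metis UNIV_I continuous_on_def subset_UNIV tendsto_within_subset)
  moreover have "F t = 0"
  proof -
    note min = local_linear_fit_minimizes[OF fit t \<open>h > 0\<close>]
    have "(\<Sum>i=1..n. K \<bar>(real i * \<Delta> - t) / h\<bar> *\<^sub>R
              (Y i - \<theta>\<^sub>0 t - ((real i * \<Delta> - t) / h) *\<^sub>R \<theta>\<^sub>1 t)) = 0"
      by (rule weighted_least_squares_normal_equations(1)[OF K_nonneg min])
    moreover have "(\<Sum>i=1..n. (K \<bar>(real i * \<Delta> - t) / h\<bar> * ((real i * \<Delta> - t) / h)) *\<^sub>R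
              (Y i - \<theta>\<^sub>0 t - ((real i * \<Delta> - t) / h) *\<^sub>R \<theta>\<^sub>1 t)) = 0"
      by (rule weighted_least_squares_normal_equations(2)[OF K_nonneg min])
    ultimately show ?thesis by (simp only: F_def) simp
  qed
  ultimately have F0: "(F \<longlongrightarrow> 0) (at t within {0..real n * \<Delta>})" by simp
  have "norm (\<theta>\<^sub>0 t' - \<theta>\<^sub>0 t) \<le> F t'" if "t' \<in> {0..real n * \<Delta>}" for t'
    using fit_error[OF assms that, of "\<theta>\<^sub>0 t" "\<theta>\<^sub>1 t"] norm_fst_le[of "\<theta>\<^sub>0 t' - \<theta>\<^sub>0 t" "\<theta>\<^sub>1 t' - \<theta>\<^sub>1 t"]
    unfolding F_def by (rule order_trans[rotated])
  then have "((\<lambda>t'. \<theta>\<^sub>0 t' - \<theta>\<^sub>0 t) \<longlongrightarrow> 0) (at t within {0..real n * \<Delta>})"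
    by (intro Lim_null_comparison[OF _ F0]) (auto simp: eventually_at_filter)
  then show "(\<theta>\<^sub>0 \<longlongrightarrow> \<theta>\<^sub>0 t) (at t within {0..real n * \<Delta>})"
    by (rule LIM_zero_cancel)
qed

end

text \<open>At most 2 * (h / \<Delta>) + 1, hence at most 3 * (h / \<Delta>), indices carry weight,
  each with a remainder of order h^2. The function g stands for both \<open>K \<bar>z\<bar>\<close>
  and \<open>K \<bar>z\<bar> * z\<close>.\<close>

lemma weighted_taylor_remainder:
  fixes f :: "real ^ 'd \<Rightarrow> real ^ 'd"
  assumes f: "f \<in> C1_class L0 L1" and u: "is_flow_line f x u" and L: "L0 \<ge> 0" "L1 \<ge> 0"
    and g: "\<And>z. \<bar>g z\<bar> \<le> C" "\<And>z. 1 < \<bar>z\<bar> \<Longrightarrow> g z = 0" and "C \<ge> 0"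
    and \<Delta>: "0 < \<Delta>" "\<Delta> \<le> h"
  shows "norm (\<Sum>i=1..n. g ((real i * \<Delta> - t) / h) *\<^sub>R
      (u (real i * \<Delta>) - u t - (real i * \<Delta> - t) *\<^sub>R f (u t)))
    \<le> 3 * C * L0 * L1 * h\<^sup>2 * (h / \<Delta>)"
proof -
  let ?W = "{i \<in> {1..n}. \<bar>(real i * \<Delta> - t) / h\<bar> \<le> 1}"
  let ?r = "\<lambda>i. g ((real i * \<Delta> - t) / h) *\<^sub>R
      (u (real i * \<Delta>) - u t - (real i * \<Delta> - t) *\<^sub>R f (u t))"
  have h: "h > 0" using \<Delta> by simp
  have "(\<Sum>i=1..n. ?r i) = (\<Sum>i\<in>?W. ?r i)"
  proof (intro sum.mono_neutral_right ballI)
    fix i assume "i \<in> {1..n} - ?W"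
    then have "1 < \<bar>(real i * \<Delta> - t) / h\<bar>" by (simp only: Diff_iff mem_Collect_eq) linarith
    then show "?r i = 0" by (simp only: g(2)) simp
  qed auto
  then have "norm (\<Sum>i=1..n. ?r i) \<le> (\<Sum>i\<in>?W. norm (?r i))"
    by (simp only: norm_sum)
  also have "\<dots> \<le> (\<Sum>i\<in>?W. C * (L0 * L1 * h\<^sup>2))"
  proof (rule sum_mono)
    fix i assume "i \<in> ?W"
    then have "\<bar>real i * \<Delta> - t\<bar> \<le> h" using h by (simp add: abs_divide)
    then have "(real i * \<Delta> - t)\<^sup>2 \<le> h\<^sup>2" by (metis abs_ge_zero power2_abs power_mono)
    then have "L0 * L1 * (real i * \<Delta> - t)\<^sup>2 \<le> L0 * L1 * h\<^sup>2"
      using L by (intro mult_left_mono) auto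
    then have "norm (u (real i * \<Delta>) - u t - (real i * \<Delta> - t) *\<^sub>R f (u t)) \<le> L0 * L1 * h\<^sup>2"
      using flow_line_taylor[OF f u L(2), of "real i * \<Delta>" t] by linarith
    then show "norm (?r i) \<le> C * (L0 * L1 * h\<^sup>2)"
      unfolding norm_scaleR using g(1) \<open>C \<ge> 0\<close> by (intro mult_mono) auto
  qed
  also have "\<dots> = real (card ?W) * (C * (L0 * L1 * h\<^sup>2))" by simp
  also have "\<dots> \<le> (3 * (h / \<Delta>)) * (C * (L0 * L1 * h\<^sup>2))"
  proof (rule mult_right_mono)
    have "1 \<le> h / \<Delta>" using \<Delta> by simp
    then show "real (card ?W) \<le> 3 * (h / \<Delta>)" using card_window_le[OF \<Delta>(1) h, of n t] by linarith
  qed (use L \<open>C \<ge> 0\<close> in simp)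
  finally show ?thesis by (simp add: algebra_simps)
qed

context local_kernel
begin

lemma first_moment_le: "\<bar>K \<bar>z\<bar> * z\<bar> \<le> C"
proof (cases "\<bar>z\<bar> \<le> 1")
  case True
  then have "K \<bar>z\<bar> * \<bar>z\<bar> \<le> C * 1"
    using K_nonneg K_le C_pos by (intro mult_mono) auto
  then show ?thesis using K_nonneg by (simp add: abs_mult)
qed (use K_zero C_pos in auto)

text \<open>The fitted slope refers to scaled time and is therefore compared with
  \<open>h *\<^sub>R f (u t)\<close>. The residuals at the truth are Taylor remainders plus noise;
  the constant 6 adds up the remainders of the two weighted sums.\<close>

lemma estimator_error:
  fixes f :: "real ^ 'd \<Rightarrow> real ^ 'd"
  assumes f: "f \<in> C1_class L0 L1" and u: "is_flow_line f x u" and L01: "L0 \<ge> 0" "L1 \<ge> 0"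
    and fit: "local_linear_fit K h n \<Delta> (\<lambda>i. u (real i * \<Delta>) + e i) (real n * \<Delta>) \<theta>\<^sub>0 \<theta>\<^sub>1"
    and \<Delta>: "0 < \<Delta>" "\<Delta> \<le> h" "2 * h \<le> real n * \<Delta>" "2 \<le> w * (h / \<Delta>)" and t: "t \<in> {0..real n * \<Delta>}"
    and B0: "norm (\<Sum>i=1..n. K \<bar>(real i * \<Delta> - t) / h\<bar> *\<^sub>R e i) \<le> B0"
    and B1: "norm (\<Sum>i=1..n. (K \<bar>(real i * \<Delta> - t) / h\<bar> * ((real i * \<Delta> - t) / h)) *\<^sub>R e i) \<le> B1"
  shows "norm (\<theta>\<^sub>0 t - u t, \<theta>\<^sub>1 t - h *\<^sub>R f (u t))
    \<le> (6 * C * L0 * L1 * h\<^sup>2 + (B0 + B1) / (h / \<Delta>)) / gram_const"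
proof -
  define z where "z = (\<lambda>i::nat. (real i * \<Delta> - t) / h)"
  define r where "r = (\<lambda>i::nat. u (real i * \<Delta>) - u t - (real i * \<Delta> - t) *\<^sub>R f (u t))"
  have h: "h > 0" using \<Delta> by simp
  have zi: "(real i * \<Delta> - t) / h = z i" for i by (simp add: z_def)
  have res: "u (real i * \<Delta>) + e i - u t - z i *\<^sub>R (h *\<^sub>R f (u t)) = r i + e i" for i
    using h by (simp add: z_def r_def)
  have S: "norm (\<Sum>i=1..n. g (z i) *\<^sub>R (r i + e i)) \<le> 3 * C * L0 * L1 * h\<^sup>2 * (h / \<Delta>) + B"
    if "\<And>z. \<bar>g z\<bar> \<le> C" "\<And>z. 1 < \<bar>z\<bar> \<Longrightarrow> g z = 0" "norm (\<Sum>i=1..n. g (z i) *\<^sub>R e i) \<le> B" for g B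
  proof -
    have "norm (\<Sum>i=1..n. g (z i) *\<^sub>R (r i + e i))
        \<le> norm (\<Sum>i=1..n. g (z i) *\<^sub>R r i) + norm (\<Sum>i=1..n. g (z i) *\<^sub>R e i)"
      unfolding scaleR_add_right sum.distrib by (rule norm_triangle_ineq)
    moreover have "norm (\<Sum>i=1..n. g (z i) *\<^sub>R r i) \<le> 3 * C * L0 * L1 * h\<^sup>2 * (h / \<Delta>)"
      unfolding z_def r_def using C_pos \<Delta>
      by (intro weighted_taylor_remainder[OF f u L01 that(1,2)]) auto
    ultimately show ?thesis using that(3) by linarith
  qed
  have S0: "norm (\<Sum>i=1..n. K \<bar>z i\<bar> *\<^sub>R (r i + e i)) \<le> 3 * C * L0 * L1 * h\<^sup>2 * (h / \<Delta>) + B0"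
    by (rule S[where g = "\<lambda>z. K \<bar>z\<bar>"]) (use K_nonneg K_le K_zero B0 in \<open>auto simp: z_def\<close>)
  have S1: "norm (\<Sum>i=1..n. (K \<bar>z i\<bar> * z i) *\<^sub>R (r i + e i)) \<le> 3 * C * L0 * L1 * h\<^sup>2 * (h / \<Delta>) + B1"
    by (rule S[where g = "\<lambda>z. K \<bar>z\<bar> * z"]) (use first_moment_le K_zero B1 in \<open>auto simp: z_def\<close>)
  have "norm (\<theta>\<^sub>0 t - u t, \<theta>\<^sub>1 t - h *\<^sub>R f (u t))
    \<le> (norm (\<Sum>i=1..n. K \<bar>z i\<bar> *\<^sub>R (r i + e i))
        + norm (\<Sum>i=1..n. (K \<bar>z i\<bar> * z i) *\<^sub>R (r i + e i))) / (gram_const * (h / \<Delta>))"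
    using fit_error[OF fit \<Delta>(1) h \<Delta>(3,4) t, of "u t" "h *\<^sub>R f (u t)", unfolded zi res] .
  also have "\<dots> \<le> (6 * C * L0 * L1 * h\<^sup>2 * (h / \<Delta>) + (B0 + B1)) / (gram_const * (h / \<Delta>))"
    using S0 S1 gram_const_pos h \<Delta>(1) by (intro divide_right_mono) auto
  also have "\<dots> = (6 * C * L0 * L1 * h\<^sup>2 + (B0 + B1) / (h / \<Delta>)) / gram_const"
    using gram_const_pos h \<Delta>(1) by (simp add: field_simps)
  finally show ?thesis .
qed

end

text \<open>E counts twice in the position error: once at the selected time, once at a time where u
  passes within \<delta> of x. The slope is compared with f at \<open>u \<tau>\<close> first, and
  its error E is divided by h together with the slope.\<close>

lemma nearest_neighbor_error:
  fixes f :: "real ^ 'd \<Rightarrow> real ^ 'd"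
  assumes f: "f \<in> C1_class L0 L1" and "L1 \<ge> 0" "h > 0" "T \<ge> 0"
    and tN: "nearest_time_selector t\<^sub>N" and cont: "continuous_on {0..T} \<theta>\<^sub>0"
    and E: "\<And>t. t \<in> {0..T} \<Longrightarrow> norm (\<theta>\<^sub>0 t - u t, \<theta>\<^sub>1 t - h *\<^sub>R f (u t)) \<le> E"
    and x: "x \<in> ball_union (u ` {0..T}) \<delta>"
  shows "norm (nn_estimator t\<^sub>N T h \<theta>\<^sub>0 \<theta>\<^sub>1 x - f x) \<le> E / h + L1 * (2 * E + \<delta>)"
proof -
  define \<tau> where "\<tau> = t\<^sub>N \<theta>\<^sub>0 T x"
  have min: "is_arg_min (\<lambda>t. norm (\<theta>\<^sub>0 t - x)) (\<lambda>t. t \<in> {0..T}) \<tau>"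
    using tN cont \<open>T \<ge> 0\<close> by (simp add: nearest_time_selector_def \<tau>_def)
  then have \<tau>: "\<tau> \<in> {0..T}" and le: "\<And>t. t \<in> {0..T} \<Longrightarrow> norm (\<theta>\<^sub>0 \<tau> - x) \<le> norm (\<theta>\<^sub>0 t - x)"
    by (auto simp: is_arg_min_linorder)
  have E0: "norm (\<theta>\<^sub>0 t - u t) \<le> E" and E1: "norm (\<theta>\<^sub>1 t - h *\<^sub>R f (u t)) \<le> E" if "t \<in> {0..T}" for t
    using E[OF that] norm_fst_le[of "\<theta>\<^sub>0 t - u t" "\<theta>\<^sub>1 t - h *\<^sub>R f (u t)"]
      norm_snd_le[of "\<theta>\<^sub>1 t - h *\<^sub>R f (u t)" "\<theta>\<^sub>0 t - u t"] by (blast intro: order_trans)+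
  obtain t0 where t0: "t0 \<in> {0..T}" "norm (u t0 - x) \<le> \<delta>"
    using x by (auto simp: ball_union_def dist_norm)
  have "norm (u \<tau> - x) \<le> norm (u \<tau> - \<theta>\<^sub>0 \<tau>) + norm (\<theta>\<^sub>0 \<tau> - x)"
    using norm_triangle_ineq[of "u \<tau> - \<theta>\<^sub>0 \<tau>" "\<theta>\<^sub>0 \<tau> - x"] by simp
  moreover have "norm (\<theta>\<^sub>0 t0 - x) \<le> norm (\<theta>\<^sub>0 t0 - u t0) + norm (u t0 - x)"
    using norm_triangle_ineq[of "\<theta>\<^sub>0 t0 - u t0" "u t0 - x"] by simp
  ultimately have ux: "norm (u \<tau> - x) \<le> 2 * E + \<delta>"
    using le[OF t0(1)] E0[OF t0(1)] E0[OF \<tau>] t0(2) by (simp add: norm_minus_commute)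
  have "(1 / h) *\<^sub>R \<theta>\<^sub>1 \<tau> - f (u \<tau>) = (1 / h) *\<^sub>R (\<theta>\<^sub>1 \<tau> - h *\<^sub>R f (u \<tau>))"
    using \<open>h > 0\<close> by (simp add: scaleR_diff_right)
  then have "norm ((1 / h) *\<^sub>R \<theta>\<^sub>1 \<tau> - f (u \<tau>)) \<le> E / h"
    using E1[OF \<tau>] \<open>h > 0\<close> by (simp add: divide_right_mono)
  moreover have "norm (f (u \<tau>) - f x) \<le> L1 * (2 * E + \<delta>)"
    using C1_class_lipschitz[OF f, of "u \<tau>" x] mult_left_mono[OF ux \<open>L1 \<ge> 0\<close>] by linarith
  ultimately show ?thesis
    using norm_triangle_ineq[of "(1 / h) *\<^sub>R \<theta>\<^sub>1 \<tau> - f (u \<tau>)" "f (u \<tau>) - f x"]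
    by (simp add: nn_estimator_def \<tau>_def)
qed

section \<open>Risk bounds and rates\<close>

lemma outer_expectation_le:
  assumes "g \<in> borel_measurable M" "\<And>\<omega>. \<omega> \<in> space M \<Longrightarrow> X \<omega> \<le> g \<omega>"
  shows "outer_expectation M X \<le> (\<integral>\<^sup>+\<omega>. g \<omega> \<partial>M)"
  unfolding outer_expectation_def using assms by (intro INF_lower) auto

lemma sup_risk_mono:
  assumes "X \<subseteq> X'"
  shows "sup_risk M X fh f \<le> sup_risk M X' fh f"
  unfolding sup_risk_def outer_expectation_def
  by (rule INF_superset_mono) (auto intro: order_trans[OF SUP_subset_mono[OF assms order_refl]])

lemma square_add_le:
  fixes x y :: real
  shows "(x + y)\<^sup>2 \<le> 2 * x\<^sup>2 + 2 * y\<^sup>2"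
  using sum_squares_bound[of x y] by (simp add: power2_sum)

text \<open>The bound for a single n, with B depending only on the kernel data, the noise level, the
  class constants and the dimension. The terms are the squared distance to the curve, the squared
  bias of the derivative estimate, and its variance ln n / N divided by h^2 because the slope is
  divided by h.\<close>

lemma (in local_kernel) sup_risk_bound:
  fixes L0 L1 s :: real
  assumes L01: "L0 \<ge> 0" "L1 \<ge> 0" and s: "s \<ge> 0"
  obtains B where "B \<ge> 0"
    "\<And>(M :: 'w measure) (\<epsilon> :: nat \<Rightarrow> 'w \<Rightarrow> real ^ 'd) f x u \<theta>\<^sub>0 \<theta>\<^sub>1 t\<^sub>N n \<Delta> h \<delta>.
       noise_model s n M \<epsilon> \<Longrightarrow> sub_gaussian_noise s n M \<epsilon> \<Longrightarrow>
       f \<in> C1_class L0 L1 \<Longrightarrow> is_flow_line f x u \<Longrightarrow>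
       (\<And>\<omega>. \<omega> \<in> space M \<Longrightarrow> local_linear_fit K h n \<Delta> (\<lambda>i. u (real i * \<Delta>) + \<epsilon> i \<omega>)
          (real n * \<Delta>) (\<theta>\<^sub>0 \<omega>) (\<theta>\<^sub>1 \<omega>)) \<Longrightarrow>
       nearest_time_selector t\<^sub>N \<Longrightarrow> 3 \<le> n \<Longrightarrow> 0 < \<Delta> \<Longrightarrow> 0 < h \<Longrightarrow> h \<le> 1 \<Longrightarrow> 2 * h \<le> real n * \<Delta> \<Longrightarrow>
       2 \<le> w * (h / \<Delta>) \<Longrightarrow> C\<^sup>2 * ln (real n) \<le> h / \<Delta> \<Longrightarrow> 0 \<le> \<delta> \<Longrightarrow>
       sup_risk M (ball_union (u ` {0..real n * \<Delta>}) \<delta>)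
         (\<lambda>\<omega>. nn_estimator t\<^sub>N (real n * \<Delta>) h (\<theta>\<^sub>0 \<omega>) (\<theta>\<^sub>1 \<omega>)) f
       \<le> ennreal (B * (\<delta>\<^sup>2 + h\<^sup>2 + ln (real n) / (h\<^sup>2 * (h / \<Delta>))))"
proof -
  have CL: "0 \<le> C + L" using C_pos L_nonneg by simp
  obtain A where A: "A \<ge> 0" and noise:
    "\<And>(M :: 'w measure) (\<epsilon> :: nat \<Rightarrow> 'w \<Rightarrow> real ^ 'd) g n \<Delta> h.
       noise_model s n M \<epsilon> \<Longrightarrow> sub_gaussian_noise s n M \<epsilon> \<Longrightarrow>
       (\<And>z. \<bar>g z\<bar> \<le> C) \<Longrightarrow> (\<And>z. 1 < \<bar>z\<bar> \<Longrightarrow> g z = 0) \<Longrightarrow>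
       (\<And>z z'. \<bar>g z - g z'\<bar> \<le> (C + L) * \<bar>z - z'\<bar>) \<Longrightarrow>
       3 \<le> n \<Longrightarrow> 0 < \<Delta> \<Longrightarrow> \<Delta> \<le> h \<Longrightarrow> C\<^sup>2 * ln (real n) \<le> h / \<Delta> \<Longrightarrow>
       \<exists>R\<in>borel_measurable M. (\<integral>\<^sup>+\<omega>. ennreal (R \<omega>) \<partial>M) \<le> ennreal (A * ((h / \<Delta>) * ln (real n))) \<and>
         (\<forall>\<omega>. \<forall>t\<in>{0..real n * \<Delta>}.
            (norm (\<Sum>i=1..n. g ((real i * \<Delta> - t) / h) *\<^sub>R \<epsilon> i \<omega>))\<^sup>2 \<le> R \<omega>)"
    using kernel_sum_noise_bound[where 'w = 'w and 'd = 'd, OF less_imp_le[OF C_pos] CL s] by blast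
  define \<kappa> where "\<kappa> = gram_const"
  have \<kappa>: "\<kappa> > 0" using gram_const_pos by (simp add: \<kappa>_def)
  define P where "P = 6 * C * L0 * L1"
  have P: "P \<ge> 0" using C_pos L01 by (simp add: P_def)
  define m where "m = 2 * (1 + 2 * L1)\<^sup>2 / \<kappa>\<^sup>2"
  have m: "m \<ge> 0" by (simp add: m_def)
  define B where "B = 2 * m * P\<^sup>2 + 2 * L1\<^sup>2 + 8 * m * A"
  show ?thesis
  proof (rule that[of B])
    show "B \<ge> 0" using m A by (simp add: B_def)
    fix M :: "'w measure" and \<epsilon> :: "nat \<Rightarrow> 'w \<Rightarrow> real ^ 'd" and f :: "real ^ 'd \<Rightarrow> real ^ 'd"
      and x and u :: "real \<Rightarrow> real ^ 'd" and \<theta>\<^sub>0 \<theta>\<^sub>1 :: "'w \<Rightarrow> real \<Rightarrow> real ^ 'd"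
      and t\<^sub>N :: "(real \<Rightarrow> real ^ 'd) \<Rightarrow> real \<Rightarrow> real ^ 'd \<Rightarrow> real" and n :: nat and \<Delta> h \<delta> :: real
    assume nm: "noise_model s n M \<epsilon>" and sg: "sub_gaussian_noise s n M \<epsilon>"
      and f: "f \<in> C1_class L0 L1" and u: "is_flow_line f x u"
      and fit: "\<And>\<omega>. \<omega> \<in> space M \<Longrightarrow> local_linear_fit K h n \<Delta> (\<lambda>i. u (real i * \<Delta>) + \<epsilon> i \<omega>)
          (real n * \<Delta>) (\<theta>\<^sub>0 \<omega>) (\<theta>\<^sub>1 \<omega>)"
      and tN: "nearest_time_selector t\<^sub>N" and n: "3 \<le> n" and \<Delta>: "0 < \<Delta>" and h: "0 < h" "h \<le> 1"
      and hT: "2 * h \<le> real n * \<Delta>" and wN: "2 \<le> w * (h / \<Delta>)"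
      and CN: "C\<^sup>2 * ln (real n) \<le> h / \<Delta>" and \<delta>: "0 \<le> \<delta>"
    interpret prob_space M using nm by (simp add: noise_model_def)
    let ?T = "real n * \<Delta>"
    define N where "N = h / \<Delta>"
    \<comment> \<open>As \<open>a + 3 * w \<le> 1\<close> gives w \<le> 1, the window condition
      yields N \<ge> 2 and thus \<Delta> \<le> h.\<close>
    have "w * N \<le> 1 * N"
      using aw_le w_pos a_nonneg h \<Delta> by (intro mult_right_mono) (auto simp: N_def)
    then have "2 \<le> N" using wN by (simp add: N_def)
    then have N: "N > 0" and \<Delta>h: "\<Delta> \<le> h" using \<Delta> by (auto simp: N_def field_simps)
    have ln0: "ln (real n) \<ge> 0" using n by simp
    have "\<exists>R\<in>borel_measurable M. (\<integral>\<^sup>+\<omega>. ennreal (R \<omega>) \<partial>M) \<le> ennreal (A * ((h / \<Delta>) * ln (real n))) \<and>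
         (\<forall>\<omega>. \<forall>t\<in>{0..?T}. (norm (\<Sum>i=1..n. K \<bar>(real i * \<Delta> - t) / h\<bar> *\<^sub>R \<epsilon> i \<omega>))\<^sup>2 \<le> R \<omega>)"
    proof (rule noise[OF nm sg _ _ _ n \<Delta> \<Delta>h CN])
      show "\<bar>K (\<bar>z\<bar>) - K (\<bar>z'\<bar>)\<bar> \<le> (C + L) * \<bar>z - z'\<bar>" for z z'
      proof -
        have "L * \<bar>z - z'\<bar> \<le> (C + L) * \<bar>z - z'\<bar>"
          using C_pos by (intro mult_right_mono) auto
        then show ?thesis using K_lipschitz[of z z'] by linarith
      qed
    qed (use K_nonneg K_le K_zero in auto)
    then obtain R0 where [measurable]: "R0 \<in> borel_measurable M"
      and ER0: "(\<integral>\<^sup>+\<omega>. ennreal (R0 \<omega>) \<partial>M) \<le> ennreal (A * (N * ln (real n)))"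
      and R0: "\<And>\<omega> t. t \<in> {0..?T} \<Longrightarrow>
        (norm (\<Sum>i=1..n. K \<bar>(real i * \<Delta> - t) / h\<bar> *\<^sub>R \<epsilon> i \<omega>))\<^sup>2 \<le> R0 \<omega>"
      unfolding N_def by blast
    have "\<exists>R\<in>borel_measurable M. (\<integral>\<^sup>+\<omega>. ennreal (R \<omega>) \<partial>M) \<le> ennreal (A * ((h / \<Delta>) * ln (real n))) \<and>
         (\<forall>\<omega>. \<forall>t\<in>{0..?T}. (norm (\<Sum>i=1..n.
            (K \<bar>(real i * \<Delta> - t) / h\<bar> * ((real i * \<Delta> - t) / h)) *\<^sub>R \<epsilon> i \<omega>))\<^sup>2 \<le> R \<omega>)"
    proof (rule noise[OF nm sg _ _ _ n \<Delta> \<Delta>h CN])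
      show "\<bar>K \<bar>z\<bar> * z - K \<bar>z'\<bar> * z'\<bar> \<le> (C + L) * \<bar>z - z'\<bar>" for z z'
        by (rule lipschitz_first_moment[where k = "\<lambda>z. K \<bar>z\<bar>"])
          (use C_pos L_nonneg K_nonneg K_le K_zero K_lipschitz in auto)
    qed (use first_moment_le K_zero in auto)
    then obtain R1 where [measurable]: "R1 \<in> borel_measurable M"
      and ER1: "(\<integral>\<^sup>+\<omega>. ennreal (R1 \<omega>) \<partial>M) \<le> ennreal (A * (N * ln (real n)))"
      and R1: "\<And>\<omega> t. t \<in> {0..?T} \<Longrightarrow>
        (norm (\<Sum>i=1..n. (K \<bar>(real i * \<Delta> - t) / h\<bar> * ((real i * \<Delta> - t) / h)) *\<^sub>R \<epsilon> i \<omega>))\<^sup>2 \<le> R1 \<omega>"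
      unfolding N_def by blast
    have T0: "0 \<in> {0..?T}" using \<Delta> by simp
    \<comment> \<open>The majorants dominate a square at t = 0.\<close>
    have R_nonneg: "0 \<le> R0 \<omega>" "0 \<le> R1 \<omega>" for \<omega>
      using R0[OF T0, of \<omega>] R1[OF T0, of \<omega>] by (meson order_trans zero_le_power2)+
    \<comment> \<open>c0 collects the deterministic part of the squared error and c1 the factor of
      the noise majorants, so that only R0 and R1 remain to be integrated.\<close>
    define c0 where "c0 = 2 * m * P\<^sup>2 * h\<^sup>2 + 2 * L1\<^sup>2 * \<delta>\<^sup>2"
    define c1 where "c1 = 4 * m / (N\<^sup>2 * h\<^sup>2)"
    have c: "c0 \<ge> 0" "c1 \<ge> 0" using m by (simp_all add: c0_def c1_def)
    have bound: "(norm (nn_estimator t\<^sub>N ?T h (\<theta>\<^sub>0 \<omega>) (\<theta>\<^sub>1 \<omega>) y - f y))\<^sup>2 \<le> c0 + c1 * (R0 \<omega> + R1 \<omega>)"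
      if \<omega>: "\<omega> \<in> space M" and y: "y \<in> ball_union (u ` {0..?T}) \<delta>" for \<omega> y
    proof -
      define W where "W = sqrt (R0 \<omega>) + sqrt (R1 \<omega>)"
      define E where "E = (P * h\<^sup>2 + W / N) / \<kappa>"
      have W: "W \<ge> 0" "W\<^sup>2 \<le> 2 * (R0 \<omega> + R1 \<omega>)"
        using R_nonneg square_add_le[of "sqrt (R0 \<omega>)" "sqrt (R1 \<omega>)"] by (auto simp: W_def)
      have E0: "E \<ge> 0" using W P N \<kappa> by (simp add: E_def)
      have E: "norm (\<theta>\<^sub>0 \<omega> t - u t, \<theta>\<^sub>1 \<omega> t - h *\<^sub>R f (u t)) \<le> E" if t: "t \<in> {0..?T}" for t
        unfolding E_def P_def W_def N_def \<kappa>_def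
        by (rule estimator_error[OF f u L01 fit[OF \<omega>] \<Delta> \<Delta>h hT wN t])
          (rule real_le_rsqrt, rule R0[OF t], rule real_le_rsqrt, rule R1[OF t])
      have "norm (nn_estimator t\<^sub>N ?T h (\<theta>\<^sub>0 \<omega>) (\<theta>\<^sub>1 \<omega>) y - f y) \<le> E / h + L1 * (2 * E + \<delta>)"
        using \<Delta> h by (intro nearest_neighbor_error[OF f L01(2) h(1) _ tN
            fit_continuous[OF fit[OF \<omega>] \<Delta> h(1) hT wN] E y]) auto
      also have "\<dots> \<le> (1 + 2 * L1) * (E / h) + L1 * \<delta>"
      proof -
        \<comment> \<open>Here h \<le> 1 lets the slope error E / h absorb the position
          error.\<close>
        have "E \<le> E / h" using E0 h by (simp add: field_simps mult_left_le)
        then have "L1 * (2 * E) \<le> L1 * (2 * (E / h))" using L01 by (intro mult_left_mono) auto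
        then show ?thesis by (simp add: algebra_simps)
      qed
      finally have "(norm (nn_estimator t\<^sub>N ?T h (\<theta>\<^sub>0 \<omega>) (\<theta>\<^sub>1 \<omega>) y - f y))\<^sup>2
          \<le> ((1 + 2 * L1) * (E / h) + L1 * \<delta>)\<^sup>2"
        by (rule power_mono) simp
      also have "\<dots> \<le> 2 * ((1 + 2 * L1) * (E / h))\<^sup>2 + 2 * (L1 * \<delta>)\<^sup>2"
        by (rule square_add_le)
      also have "2 * ((1 + 2 * L1) * (E / h))\<^sup>2 = m * (P * h\<^sup>2 + W / N)\<^sup>2 / h\<^sup>2"
        by (simp add: m_def E_def power_mult_distrib power_divide)
      also have "\<dots> \<le> m * (2 * (P * h\<^sup>2)\<^sup>2 + 2 * (W / N)\<^sup>2) / h\<^sup>2"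
        using m by (intro divide_right_mono mult_left_mono square_add_le) auto
      also have "\<dots> = 2 * m * P\<^sup>2 * h\<^sup>2 + 2 * m / (N\<^sup>2 * h\<^sup>2) * W\<^sup>2"
        using h N by (simp add: power_mult_distrib power_divide field_simps power2_eq_square)
      also have "\<dots> \<le> 2 * m * P\<^sup>2 * h\<^sup>2 + 2 * m / (N\<^sup>2 * h\<^sup>2) * (2 * (R0 \<omega> + R1 \<omega>))"
        using m W(2) by (intro add_left_mono mult_left_mono) auto
      also have "2 * m * P\<^sup>2 * h\<^sup>2 + 2 * m / (N\<^sup>2 * h\<^sup>2) * (2 * (R0 \<omega> + R1 \<omega>)) + 2 * (L1 * \<delta>)\<^sup>2
          = c0 + c1 * (R0 \<omega> + R1 \<omega>)"
      proof -
        have "2 * m / X * (2 * r) = 4 * m / X * r" for X r :: real by simp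
        then show ?thesis by (simp only: c0_def c1_def power_mult_distrib)
      qed
      finally show ?thesis by simp
    qed
    have "sup_risk M (ball_union (u ` {0..?T}) \<delta>) (\<lambda>\<omega>. nn_estimator t\<^sub>N ?T h (\<theta>\<^sub>0 \<omega>) (\<theta>\<^sub>1 \<omega>)) f
        \<le> (\<integral>\<^sup>+\<omega>. ennreal c0 + ennreal c1 * (ennreal (R0 \<omega>) + ennreal (R1 \<omega>)) \<partial>M)"
      unfolding sup_risk_def
    proof (rule outer_expectation_le)
      fix \<omega> assume "\<omega> \<in> space M"
      then show "(SUP y\<in>ball_union (u ` {0..?T}) \<delta>.
          ennreal ((norm (nn_estimator t\<^sub>N ?T h (\<theta>\<^sub>0 \<omega>) (\<theta>\<^sub>1 \<omega>) y - f y))\<^sup>2))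
          \<le> ennreal c0 + ennreal c1 * (ennreal (R0 \<omega>) + ennreal (R1 \<omega>))"
        using bound c R_nonneg
        by (intro SUP_least)
          (simp add: ennreal_mult[symmetric] ennreal_plus[symmetric] ennreal_leI del: ennreal_plus)
    qed measurable
    also have "\<dots> = ennreal c0 + ennreal c1 * ((\<integral>\<^sup>+\<omega>. ennreal (R0 \<omega>) \<partial>M) + (\<integral>\<^sup>+\<omega>. ennreal (R1 \<omega>) \<partial>M))"
      by (simp add: nn_integral_add nn_integral_cmult emeasure_space_1)
    also have "\<dots> \<le> ennreal c0 + ennreal c1 * (ennreal (A * (N * ln (real n))) + ennreal (A * (N * ln (real n))))"
      using ER0 ER1 by (intro add_left_mono mult_left_mono add_mono) auto
    also have "\<dots> = ennreal (c0 + c1 * (A * (N * ln (real n)) + A * (N * ln (real n))))"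
      using c A N ln0 by (simp add: ennreal_mult[symmetric] ennreal_plus[symmetric] del: ennreal_plus)
    also have "\<dots> \<le> ennreal (B * (\<delta>\<^sup>2 + h\<^sup>2 + ln (real n) / (h\<^sup>2 * (h / \<Delta>))))"
    proof (rule ennreal_leI)
      define r where "r = ln (real n) / (h\<^sup>2 * N)"
      have r: "r \<ge> 0" using ln0 N by (simp add: r_def)
      have "c1 * (A * (N * ln (real n)) + A * (N * ln (real n))) = 8 * m * A * r"
        using h N by (simp add: c1_def r_def field_simps power2_eq_square)
      moreover have "2 * m * P\<^sup>2 * h\<^sup>2 + 2 * L1\<^sup>2 * \<delta>\<^sup>2 + 8 * m * A * r \<le> B * h\<^sup>2 + B * \<delta>\<^sup>2 + B * r"
        using m A r by (intro add_mono mult_right_mono) (auto simp: B_def)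
      ultimately show "c0 + c1 * (A * (N * ln (real n)) + A * (N * ln (real n)))
          \<le> B * (\<delta>\<^sup>2 + h\<^sup>2 + ln (real n) / (h\<^sup>2 * (h / \<Delta>)))"
        by (simp add: c0_def r_def N_def algebra_simps)
    qed
    finally show "sup_risk M (ball_union (u ` {0..?T}) \<delta>)
         (\<lambda>\<omega>. nn_estimator t\<^sub>N ?T h (\<theta>\<^sub>0 \<omega>) (\<theta>\<^sub>1 \<omega>)) f
       \<le> ennreal (B * (\<delta>\<^sup>2 + h\<^sup>2 + ln (real n) / (h\<^sup>2 * (h / \<Delta>))))" .
  qed
qed

section \<open>Asymptotic rates of the bandwidth and the risk\<close>

lemma asymp_le_realE:
  fixes a b :: "nat \<Rightarrow> real"
  assumes "asymp_le (\<lambda>n. ennreal (a n)) (\<lambda>n. ennreal (b n))" "\<And>n. b n \<ge> 0"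
  obtains C where "C > 0" "\<forall>\<^sub>F n in sequentially. a n \<le> C * b n"
proof -
  obtain C where C: "C > 0" "\<forall>\<^sub>F n in sequentially. ennreal (a n) \<le> ennreal C * ennreal (b n)"
    using asymp_leE[OF assms(1)] by blast
  have "\<forall>\<^sub>F n in sequentially. a n \<le> C * b n"
    using C(2) by eventually_elim
      (use C(1) assms(2) in \<open>simp add: ennreal_mult[symmetric] ennreal_le_iff\<close>)
  then show ?thesis by (rule that[OF C(1)])
qed

text \<open>For n \<le> 1 the quotient n / ln n is 0 by the conventions for division and powers of
  zero, so the rate degenerates there.\<close>

lemma log_rate_eventually_proper: "\<forall>\<^sub>F n in sequentially. log_rate p n \<noteq> 0 \<and> log_rate p n \<noteq> \<top>"
  using eventually_ge_at_top[of 2]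
  by eventually_elim (auto simp: log_rate_def ennreal_eq_0_iff not_le)

lemma ln_over_powr_tendsto_0:
  assumes "p > 0"
  shows "(\<lambda>n. (real n / ln (real n)) powr (- p)) \<longlonglongrightarrow> 0"
proof -
  have "(\<lambda>n. (ln (real n) / real n) powr p) \<longlonglongrightarrow> 0"
  proof (rule tendsto_zero_powrI[OF _ tendsto_const _ assms])
    show "(\<lambda>n. ln (real n) / real n) \<longlonglongrightarrow> 0" using lim_ln_over_n by simp
    show "\<forall>\<^sub>F n in sequentially. 0 \<le> ln (real n) / real n"
      using eventually_ge_at_top[of 1] by eventually_elim simp
  qed
  moreover have "(ln (real n) / real n) powr p = (real n / ln (real n)) powr (- p)" for n
    by (cases "n = 0") (auto simp: powr_minus powr_divide field_simps)
  ultimately show ?thesis by simp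
qed

text \<open>With \<open>h\<close> of order \<open>(T ln n / n) powr (1 / 5)\<close> and the bound on \<open>T\<close>, the exponents add up
  to \<open>(d - 1) / (4 + d) - 1 = - 5 / (4 + d)\<close>, so that \<open>h\<close> is bounded by the rate.\<close>

lemma bandwidth_bounds:
  fixes T h :: "nat \<Rightarrow> real" and d :: real
  assumes d: "d > 0" and T: "\<And>n. T n \<ge> 0" and h: "\<And>n. h n > 0"
    and asy: "asymp_eq (\<lambda>n. ennreal (h n)) (\<lambda>n. ennreal ((T n * ln (real n) / real n) powr (1 / 5)))"
    and Tb: "asymp_le (\<lambda>n. ennreal (T n)) (log_rate ((d - 1) / (4 + d)))"
  obtains c c' where "c > 0" "c' > 0"
    "\<forall>\<^sub>F n in sequentially. h n \<le> c * (real n / ln (real n)) powr (- 1 / (4 + d))"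
    "\<forall>\<^sub>F n in sequentially. T n / real n * ln (real n) \<le> c' * h n ^ 5"
proof -
  define q where "q = (\<lambda>n. (T n * ln (real n) / real n) powr (1 / 5))"
  define \<rho> where "\<rho> = (\<lambda>n. (real n / ln (real n)) powr (- 1 / (4 + d)))"
  obtain c1 where c1: "c1 > 0" "\<forall>\<^sub>F n in sequentially. h n \<le> c1 * q n"
    using asy unfolding asymp_eq_def q_def by (auto elim: asymp_le_realE)
  obtain c2 where c2: "c2 > 0" "\<forall>\<^sub>F n in sequentially. q n \<le> c2 * h n"
    using asy h unfolding asymp_eq_def q_def by (auto elim!: asymp_le_realE simp: less_imp_le)
  obtain c3 where c3: "c3 > 0"
    "\<forall>\<^sub>F n in sequentially. T n \<le> c3 * (real n / ln (real n)) powr ((d - 1) / (4 + d))"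
    using Tb unfolding log_rate_def by (auto elim: asymp_le_realE)
  have powr_fifth: "(x powr (1 / 5)) ^ 5 = x" if "x \<ge> 0" for x :: real
    using that by (cases "x = 0") (simp_all add: powr_power)
  have q5: "q n ^ 5 = T n * ln (real n) / real n" for n
  proof -
    have "0 \<le> T n * ln (real n) / real n" using T[of n] by (cases "n = 0") auto
    then show ?thesis using powr_fifth by (simp only: q_def)
  qed
  have q0: "q n \<ge> 0" for n by (simp add: q_def)
  have "\<forall>\<^sub>F n in sequentially. h n \<le> c1 * (1 + c3) * \<rho> n"
    using c1(2) c3(2) eventually_ge_at_top[of 2]
  proof eventually_elim
    case (elim n)
    have ln: "ln (real n) > 0" "real n > 0" using elim by auto
    define y where "y = real n / ln (real n)"
    have y: "y > 0" using ln by (simp add: y_def)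
    have "T n * ln (real n) / real n \<le> (c3 * y powr ((d - 1) / (4 + d))) * ln (real n) / real n"
      using elim ln by (intro divide_right_mono mult_right_mono) (auto simp: y_def)
    also have "\<dots> = c3 * (y powr ((d - 1) / (4 + d)) * y powr (- 1))"
      using y ln by (simp add: powr_minus powr_one y_def)
    also have "y powr ((d - 1) / (4 + d)) * y powr (- 1) = y powr ((- 1 / (4 + d)) * 5)"
      using d unfolding powr_add[symmetric] by (intro arg_cong2[where f = "(powr)"]) (auto simp: field_simps)
    also have "\<dots> = \<rho> n ^ 5"
      unfolding \<rho>_def y_def[symmetric] using y by (subst powr_power) (simp_all add: mult.commute)
    finally have q5r: "q n ^ 5 \<le> c3 * \<rho> n ^ 5" by (simp add: q5)
    have "h n ^ 5 \<le> (c1 * q n) ^ 5"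
      using elim h[of n] by (intro power_mono) auto
    also have "\<dots> \<le> c1 ^ 5 * (c3 * \<rho> n ^ 5)"
      unfolding power_mult_distrib using q5r c1(1) by (intro mult_left_mono) auto
    \<comment> \<open>Replacing c3 by (1 + c3)^5 makes the right side a fifth power and avoids the
      fifth root of c3.\<close>
    also have "\<dots> \<le> c1 ^ 5 * ((1 + c3) ^ 5 * \<rho> n ^ 5)"
    proof (intro mult_left_mono mult_right_mono)
      have "(1 + c3) ^ 1 \<le> (1 + c3) ^ 5" using c3(1) by (intro power_increasing) auto
      then show "c3 \<le> (1 + c3) ^ 5" by simp
    qed (use c1(1) in \<open>auto simp: \<rho>_def\<close>)
    also have "\<dots> = (c1 * (1 + c3) * \<rho> n) ^ 5" by (simp add: power_mult_distrib)
    finally show ?case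
      using c1(1) c3(1) by (rule_tac power_le_imp_le_base[of _ 4]) (auto simp: \<rho>_def)
  qed
  \<comment> \<open>This is the lower bound on the bandwidth; it limits the variance, since T / n is
    the time step.\<close>
  moreover have "\<forall>\<^sub>F n in sequentially. T n / real n * ln (real n) \<le> c2 ^ 5 * h n ^ 5"
    using c2(2)
  proof eventually_elim
    case (elim n)
    have "q n ^ 5 \<le> (c2 * h n) ^ 5" using elim q0 by (intro power_mono) auto
    then show ?case by (simp add: q5 power_mult_distrib)
  qed
  ultimately show ?thesis
    using c1(1) c2(1) c3(1) by (intro that[of "c1 * (1 + c3)" "c2 ^ 5"]) (auto simp: \<rho>_def)
qed

text \<open>The bandwidth relation gives \<Delta> * ln n \<le> c' * h^5, that is, ln n / N \<le> c'
  * h^4. As h tends to 0, every requirement that N exceed a multiple of ln n holds eventually, and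
  the variance ln n / (h^2 * N) is at most c' * h^2, the order of the squared bias.\<close>

lemma nn_estimator_rate:
  fixes L\<^sub>0 L\<^sub>1 \<sigma> :: real and f :: "nat \<Rightarrow> real ^ 'd \<Rightarrow> real ^ 'd" and M :: "nat \<Rightarrow> 'w measure"
  assumes L: "L\<^sub>0 > 0" "L\<^sub>1 > 0" and \<sigma>: "\<sigma> \<ge> 0" and K: "kernel_assumption K"
    and f: "\<And>n. f n \<in> C1_class L\<^sub>0 L\<^sub>1" and \<Delta>: "\<And>n. \<Delta> n > 0"
    and u: "\<And>n. is_flow_line (f n) (x n) (u n)"
    and noise: "\<And>n. noise_model \<sigma> n (M n) (\<epsilon> n)" "\<And>n. sub_gaussian_noise \<sigma> n (M n) (\<epsilon> n)"
    and h: "\<And>n. h n > 0"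
    and asy: "asymp_eq (\<lambda>n. ennreal (h n))
      (\<lambda>n. ennreal ((real n * \<Delta> n * ln (real n) / real n) powr (1 / 5)))"
    and fit: "\<And>n \<omega>. \<omega> \<in> space (M n) \<Longrightarrow> local_linear_fit K (h n) n (\<Delta> n)
      (\<lambda>i. u n (real i * \<Delta> n) + \<epsilon> n i \<omega>) (real n * \<Delta> n) (\<theta>\<^sub>0 n \<omega>) (\<theta>\<^sub>1 n \<omega>)"
    and tN: "\<And>n. nearest_time_selector (t\<^sub>N n)"
    and \<delta>: "\<And>n. \<delta> n \<ge> 0" and hT: "\<forall>\<^sub>F n in sequentially. 2 * h n \<le> real n * \<Delta> n"
    and Tb: "asymp_le (\<lambda>n. ennreal (real n * \<Delta> n))
      (log_rate ((real CARD('d) - 1) / (4 + real CARD('d))))"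
    and \<delta>b: "asymp_le (\<lambda>n. ennreal (\<delta> n)) (log_rate (- 1 / (4 + real CARD('d))))"
  shows "asymp_le (\<lambda>n. sup_risk (M n) (ball_union (u n ` {0..real n * \<Delta> n}) (\<delta> n))
      (\<lambda>\<omega>. nn_estimator (t\<^sub>N n) (real n * \<Delta> n) (h n) (\<theta>\<^sub>0 n \<omega>) (\<theta>\<^sub>1 n \<omega>)) (f n))
    (log_rate (- 2 / (4 + real CARD('d))))"
proof -
  define d where "d = real CARD('d)"
  have d: "d > 0" by (simp add: d_def)
  define \<rho> where "\<rho> = (\<lambda>n. (real n / ln (real n)) powr (- 1 / (4 + d)))"
  have T0: "real n * \<Delta> n \<ge> 0" for n using \<Delta>[of n] by simp
  obtain c c' where c: "c > 0" "c' > 0" and hc: "\<forall>\<^sub>F n in sequentially. h n \<le> c * \<rho> n"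
    and hc': "\<forall>\<^sub>F n in sequentially. real n * \<Delta> n / real n * ln (real n) \<le> c' * h n ^ 5"
    using bandwidth_bounds[where T = "\<lambda>n. real n * \<Delta> n", OF d T0 h asy Tb[folded d_def]]
    unfolding \<rho>_def by blast
  obtain c4 where c4: "c4 > 0" "\<forall>\<^sub>F n in sequentially. \<delta> n \<le> c4 * \<rho> n"
    using \<delta>b unfolding log_rate_def \<rho>_def d_def by (auto elim: asymp_le_realE)
  have \<rho>0: "\<rho> \<longlonglongrightarrow> 0"
    using ln_over_powr_tendsto_0[of "1 / (4 + d)"] d by (simp add: \<rho>_def)
  obtain C L a w b where "local_kernel K C L a w b"
    using kernel_assumptionE[OF K] .
  then interpret local_kernel K C L a w b .
  obtain B where B: "B \<ge> 0" and risk: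
    "\<And>(M :: 'w measure) (\<epsilon> :: nat \<Rightarrow> 'w \<Rightarrow> real ^ 'd) f x u \<theta>\<^sub>0 \<theta>\<^sub>1 t\<^sub>N n \<Delta> h \<delta>.
       noise_model \<sigma> n M \<epsilon> \<Longrightarrow> sub_gaussian_noise \<sigma> n M \<epsilon> \<Longrightarrow>
       f \<in> C1_class L\<^sub>0 L\<^sub>1 \<Longrightarrow> is_flow_line f x u \<Longrightarrow>
       (\<And>\<omega>. \<omega> \<in> space M \<Longrightarrow> local_linear_fit K h n \<Delta> (\<lambda>i. u (real i * \<Delta>) + \<epsilon> i \<omega>)
          (real n * \<Delta>) (\<theta>\<^sub>0 \<omega>) (\<theta>\<^sub>1 \<omega>)) \<Longrightarrow>
       nearest_time_selector t\<^sub>N \<Longrightarrow> 3 \<le> n \<Longrightarrow> 0 < \<Delta> \<Longrightarrow> 0 < h \<Longrightarrow> h \<le> 1 \<Longrightarrow> 2 * h \<le> real n * \<Delta> \<Longrightarrow>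
       2 \<le> w * (h / \<Delta>) \<Longrightarrow> C\<^sup>2 * ln (real n) \<le> h / \<Delta> \<Longrightarrow> 0 \<le> \<delta> \<Longrightarrow>
       sup_risk M (ball_union (u ` {0..real n * \<Delta>}) \<delta>)
         (\<lambda>\<omega>. nn_estimator t\<^sub>N (real n * \<Delta>) h (\<theta>\<^sub>0 \<omega>) (\<theta>\<^sub>1 \<omega>)) f
       \<le> ennreal (B * (\<delta>\<^sup>2 + h\<^sup>2 + ln (real n) / (h\<^sup>2 * (h / \<Delta>))))"
    using sup_risk_bound[where 'w = 'w and 'd = 'd, OF less_imp_le[OF L(1)] less_imp_le[OF L(2)] \<sigma>] by blast
  have h0: "h \<longlonglongrightarrow> 0"
  proof (rule tendsto_sandwich[OF _ hc tendsto_const])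
    show "\<forall>\<^sub>F n in sequentially. 0 \<le> h n" using h by (simp add: less_imp_le)
    show "(\<lambda>n. c * \<rho> n) \<longlonglongrightarrow> 0" using tendsto_mult_right_zero[OF \<rho>0, of c] .
  qed
  have h4: "(\<lambda>n. k * c' * h n ^ 4) \<longlonglongrightarrow> 0" for k
    using tendsto_mult_right_zero[OF tendsto_null_power[OF h0, of 4], of "k * c'"] by simp
  have ev1: "\<forall>\<^sub>F n in sequentially. h n < 1"
    using order_tendstoD(2)[OF h0] by simp
  have ev2: "\<forall>\<^sub>F n in sequentially. (2 / w) * c' * h n ^ 4 < 1"
    by (rule order_tendstoD(2)[OF h4]) simp
  have ev3: "\<forall>\<^sub>F n in sequentially. C\<^sup>2 * c' * h n ^ 4 < 1"
    by (rule order_tendstoD(2)[OF h4]) simp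
  define D where "D = B * (c4\<^sup>2 + c\<^sup>2 + c' * c\<^sup>2)"
  have "\<forall>\<^sub>F n in sequentially. sup_risk (M n) (ball_union (u n ` {0..real n * \<Delta> n}) (\<delta> n))
      (\<lambda>\<omega>. nn_estimator (t\<^sub>N n) (real n * \<Delta> n) (h n) (\<theta>\<^sub>0 n \<omega>) (\<theta>\<^sub>1 n \<omega>)) (f n)
      \<le> ennreal D * log_rate (- 2 / (4 + d)) n"
    using hc hc' c4(2) ev1 ev2 ev3 hT eventually_ge_at_top[of 3]
  proof eventually_elim
    case (elim n)
    have n: "3 \<le> n" and h1: "h n < 1" and hTn: "2 * h n \<le> real n * \<Delta> n" using elim by auto
    have ln1: "ln (real n) \<ge> 1" using n by (rule ln_ge_1)
    have \<Delta>h: "\<Delta> n * ln (real n) \<le> c' * h n ^ 5"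
      using elim n by simp
    have hp: "h n > 0" by (rule h)
    \<comment> \<open>Used with k = 2 / w for the number of design points and with
      \<open>k = C\<^sup>2\<close> for the range of the moment bound.\<close>
    have big: "k * ln (real n) \<le> h n / \<Delta> n" if "k * c' * h n ^ 4 < 1" "k \<ge> 0" for k
    proof -
      have "k * (\<Delta> n * ln (real n)) \<le> k * (c' * h n ^ 5)"
        using \<Delta>h that by (intro mult_left_mono) auto
      also have "\<dots> = (k * c' * h n ^ 4) * h n" by (simp add: power_numeral_reduce)
      also have "\<dots> \<le> 1 * h n" using that hp by (intro mult_right_mono) auto
      finally show ?thesis using \<Delta>[of n] by (simp add: field_simps)
    qed
    have "2 / w * 1 \<le> 2 / w * ln (real n)" using ln1 w_pos by (intro mult_left_mono) auto
    also have "\<dots> \<le> h n / \<Delta> n" using elim w_pos by (intro big) auto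
    finally have wN: "2 \<le> w * (h n / \<Delta> n)" using w_pos by (simp add: field_simps)
    have CN: "C\<^sup>2 * ln (real n) \<le> h n / \<Delta> n" using elim by (intro big) auto
    have "ln (real n) / ((h n)\<^sup>2 * (h n / \<Delta> n)) = \<Delta> n * ln (real n) / h n ^ 3"
      by (simp add: power2_eq_square power3_eq_cube)
    also have "\<dots> \<le> c' * h n ^ 5 / h n ^ 3"
      using \<Delta>h hp by (intro divide_right_mono) auto
    also have "\<dots> = c' * (h n)\<^sup>2"
      using hp by (simp add: power_numeral_reduce)
    finally have r: "ln (real n) / ((h n)\<^sup>2 * (h n / \<Delta> n)) \<le> c' * (h n)\<^sup>2" .
    have h2: "(h n)\<^sup>2 \<le> c\<^sup>2 * (\<rho> n)\<^sup>2"
      using elim hp by (metis less_imp_le power_mono power_mult_distrib)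
    have d2: "(\<delta> n)\<^sup>2 \<le> c4\<^sup>2 * (\<rho> n)\<^sup>2"
      using elim \<delta>[of n] by (metis power_mono power_mult_distrib)
    have "c' * (h n)\<^sup>2 \<le> c' * (c\<^sup>2 * (\<rho> n)\<^sup>2)" using h2 c by (intro mult_left_mono) auto
    then have "(\<delta> n)\<^sup>2 + (h n)\<^sup>2 + ln (real n) / ((h n)\<^sup>2 * (h n / \<Delta> n))
        \<le> (c4\<^sup>2 + c\<^sup>2 + c' * c\<^sup>2) * (\<rho> n)\<^sup>2"
      using r h2 d2 by (simp add: algebra_simps)
    then have le: "B * ((\<delta> n)\<^sup>2 + (h n)\<^sup>2 + ln (real n) / ((h n)\<^sup>2 * (h n / \<Delta> n))) \<le> D * (\<rho> n)\<^sup>2"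
      unfolding D_def mult.assoc[of B] using B by (rule mult_left_mono)
    have "\<rho> n ^ 2 = (real n / ln (real n)) powr (- 2 / (4 + d))"
      unfolding \<rho>_def using n ln1 by (subst powr_power) auto
    then have \<rho>2: "ennreal (D * (\<rho> n)\<^sup>2) = ennreal D * log_rate (- 2 / (4 + d)) n"
      using B c by (simp add: log_rate_def D_def ennreal_mult)
    have "sup_risk (M n) (ball_union (u n ` {0..real n * \<Delta> n}) (\<delta> n))
      (\<lambda>\<omega>. nn_estimator (t\<^sub>N n) (real n * \<Delta> n) (h n) (\<theta>\<^sub>0 n \<omega>) (\<theta>\<^sub>1 n \<omega>)) (f n)
      \<le> ennreal (B * ((\<delta> n)\<^sup>2 + (h n)\<^sup>2 + ln (real n) / ((h n)\<^sup>2 * (h n / \<Delta> n))))"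
      by (rule risk[OF noise f u fit tN n \<Delta> h less_imp_le[OF h1] hTn wN CN \<delta>])
    also have "\<dots> \<le> ennreal (D * (\<rho> n)\<^sup>2)" by (rule ennreal_leI[OF le])
    finally show ?case unfolding \<rho>2 .
  qed
  then show ?thesis
    using log_rate_eventually_proper unfolding d_def by (rule asymp_leI)
qed

section \<open>Covering the unit cube by neighbourhoods of the trajectory\<close>

lemma norm_unit_cube_le:
  fixes x :: "real ^ 'd"
  assumes "x \<in> unit_cube"
  shows "norm x \<le> real CARD('d)"
proof -
  have "norm x \<le> (\<Sum>k\<in>UNIV. \<bar>x $ k\<bar>)" by (rule norm_le_l1_cart)
  also have "\<dots> \<le> (\<Sum>k\<in>(UNIV :: 'd set). 1)"
    using assms by (intro sum_mono) (simp add: unit_cube_def)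
  finally show ?thesis by simp
qed

text \<open>Distances to the curve are attained on the compact time interval, so closed balls of
  radius exactly r suffice. The real supremum bounds these distances because the cube, and with it
  the family of distances, is bounded.\<close>

lemma covering_radius_unit_cube:
  fixes u :: "real \<Rightarrow> real ^ 'd"
  assumes "T \<ge> 0" and cont: "continuous_on {0..T} u"
  defines "r \<equiv> (SUP x\<in>unit_cube. INF t\<in>{0..T}. norm (u t - x))"
  shows "r \<ge> 0" and "unit_cube \<subseteq> ball_union (u ` {0..T}) r"
proof -
  let ?d = "\<lambda>x. INF t\<in>{0..T}. norm (u t - x)"
  have bdd: "bdd_below ((\<lambda>t. norm (u t - x)) ` {0..T})" for x
    by (rule bdd_belowI[of _ 0]) auto
  have "bdd_above (?d ` unit_cube)"
  proof (rule bdd_aboveI2)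
    fix x :: "real ^ 'd" assume x: "x \<in> unit_cube"
    have "?d x \<le> norm (u 0 - x)" using bdd \<open>T \<ge> 0\<close> by (intro cINF_lower) auto
    also have "\<dots> \<le> norm (u 0) + norm x" by (rule norm_triangle_ineq4)
    finally show "?d x \<le> norm (u 0) + real CARD('d)" using norm_unit_cube_le[OF x] by simp
  qed
  then have le: "?d x \<le> r" if "x \<in> unit_cube" for x
    unfolding r_def using that by (intro cSUP_upper) auto
  have "0 \<le> ?d 0" using \<open>T \<ge> 0\<close> by (intro cINF_greatest) auto
  also have "\<dots> \<le> r" by (rule le) (simp add: unit_cube_def)
  finally show "r \<ge> 0" .
  show "unit_cube \<subseteq> ball_union (u ` {0..T}) r"
  proof
    fix x :: "real ^ 'd" assume x: "x \<in> unit_cube"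
    have "\<exists>t\<in>{0..T}. \<forall>s\<in>{0..T}. norm (u t - x) \<le> norm (u s - x)"
      using \<open>T \<ge> 0\<close> by (intro continuous_attains_inf continuous_intros cont) auto
    then obtain t where t: "t \<in> {0..T}" "\<And>s. s \<in> {0..T} \<Longrightarrow> norm (u t - x) \<le> norm (u s - x)"
      by blast
    have "norm (u t - x) \<le> ?d x" using \<open>T \<ge> 0\<close> t(2) by (intro cINF_greatest) auto
    also have "\<dots> \<le> r" by (rule le[OF x])
    finally show "x \<in> ball_union (u ` {0..T}) r"
      using t(1) by (auto simp: ball_union_def dist_norm)
  qed
qed

text \<open>The origin and a unit vector of the cube are at distance 1, and the curve comes within 1
  / 4 of both. It must therefore cover a distance of 1 / 2 at speed at most L0.\<close>

lemma covering_time_lower_bound: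
  fixes f :: "real ^ 'd \<Rightarrow> real ^ 'd"
  assumes f: "f \<in> C1_class L0 L1" "is_flow_line f x u" and "T \<ge> 0"
    and cover: "unit_cube \<subseteq> ball_union (u ` {0..T}) r" and r: "r \<le> 1 / 4"
  shows "1 / 2 \<le> L0 * T"
proof -
  \<comment> \<open>This only names some coordinate.\<close>
  obtain k :: 'd where True by blast
  have "0 \<in> ball_union (u ` {0..T}) r" "axis k 1 \<in> ball_union (u ` {0..T}) r"
    using cover by (auto simp: unit_cube_def axis_def)
  then obtain s t where st: "s \<in> {0..T}" "t \<in> {0..T}" "norm (u s) \<le> r" "norm (u t - axis k 1) \<le> r"
    by (auto simp: ball_union_def dist_norm)
  have "norm (axis k 1 :: real ^ 'd) = 1" by simp
  also have "axis k 1 = (u t - u s) + u s - (u t - axis k 1)" by simp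
  also have "norm \<dots> \<le> norm (u t - u s) + norm (u s) + norm (u t - axis k 1)"
    by (meson add_right_mono norm_triangle_ineq norm_triangle_ineq4 order_trans)
  finally have "1 / 2 \<le> norm (u t - u s)" using st r by simp
  also have "\<dots> \<le> L0 * \<bar>t - s\<bar>" by (rule flow_line_lipschitz[OF f])
  also have "\<dots> \<le> L0 * T"
    using st C1_class_norm_le[OF f(1), of 0] by (intro mult_left_mono) (auto intro: order_trans[OF norm_ge_zero])
  finally show ?thesis .
qed

lemma flow_line_continuous: "is_flow_line f x u \<Longrightarrow> continuous_on S u"
  by (meson continuous_at_imp_continuous_on has_vector_derivative_continuous is_flow_line_def)

theorem corollary4p6:
  fixes L\<^sub>0 L\<^sub>1 \<sigma> :: real
    and K :: "real \<Rightarrow> real"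
    and f :: "nat \<Rightarrow> real ^ 'd \<Rightarrow> real ^ 'd"
    and x\<^sub>1 :: "nat \<Rightarrow> real ^ 'd"
    and \<Delta>t T h :: "nat \<Rightarrow> real"
    and u :: "nat \<Rightarrow> real \<Rightarrow> real ^ 'd"
    and M :: "nat \<Rightarrow> 'w measure"
    and \<epsilon> Y :: "nat \<Rightarrow> nat \<Rightarrow> 'w \<Rightarrow> real ^ 'd"
    and \<theta>\<^sub>0 \<theta>\<^sub>1 :: "nat \<Rightarrow> 'w \<Rightarrow> real \<Rightarrow> real ^ 'd"
    and t\<^sub>N :: "nat \<Rightarrow> (real \<Rightarrow> real ^ 'd) \<Rightarrow> real \<Rightarrow> real ^ 'd \<Rightarrow> real"
    and fh :: "nat \<Rightarrow> 'w \<Rightarrow> real ^ 'd \<Rightarrow> real ^ 'd"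
  assumes "CARD('d) \<ge> 2" and "L\<^sub>0 > 0" and "L\<^sub>1 > 0" and "\<sigma> \<ge> 0"
    and "kernel_assumption K"
    and "\<And>n. f n \<in> C1_class L\<^sub>0 L\<^sub>1"
    and "\<And>n. \<Delta>t n > 0"
    and "\<And>n. T n = real n * \<Delta>t n"
    and "\<And>n. is_flow_line (f n) (x\<^sub>1 n) (u n)"
    and "\<And>n. noise_model \<sigma> n (M n) (\<epsilon> n)"
    and "\<And>n. sub_gaussian_noise \<sigma> n (M n) (\<epsilon> n)"
    and "\<And>n i \<omega>. Y n i \<omega> = u n (real i * \<Delta>t n) + \<epsilon> n i \<omega>"
    and "\<And>n. h n > 0"
    and "asymp_eq (\<lambda>n. ennreal (h n)) (\<lambda>n. ennreal ((T n * ln (real n) / real n) powr (1 / 5)))"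
    and "\<And>n \<omega>. \<omega> \<in> space (M n) \<Longrightarrow>
           local_linear_fit K (h n) n (\<Delta>t n) (\<lambda>i. Y n i \<omega>) (T n) (\<theta>\<^sub>0 n \<omega>) (\<theta>\<^sub>1 n \<omega>)"
    and "\<And>n. nearest_time_selector (t\<^sub>N n)"
    and "\<And>n \<omega> x. fh n \<omega> x = nn_estimator (t\<^sub>N n) (T n) (h n) (\<theta>\<^sub>0 n \<omega>) (\<theta>\<^sub>1 n \<omega>) x"
  shows
    "(\<forall>\<delta> :: nat \<Rightarrow> real.
        (\<forall>n. \<delta> n \<ge> 0) \<longrightarrow>
        (\<forall>\<^sub>F n in sequentially. 2 * h n \<le> T n) \<longrightarrow>
        asymp_le (\<lambda>n. ennreal (T n)) (log_rate ((real CARD('d) - 1) / (4 + real CARD('d)))) \<longrightarrow>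
        asymp_le (\<lambda>n. ennreal (\<delta> n)) (log_rate (- 1 / (4 + real CARD('d)))) \<longrightarrow>
        asymp_le (\<lambda>n. sup_risk (M n) (ball_union (u n ` {0..T n}) (\<delta> n)) (fh n) (f n))
                 (log_rate (- 2 / (4 + real CARD('d)))))
     \<and>
     (let \<delta> = (\<lambda>n. SUP x\<in>unit_cube. INF t\<in>{0..T n}. norm (u n t - x)) in
        asymp_le (\<lambda>n. ennreal (T n)) (log_rate ((real CARD('d) - 1) / (4 + real CARD('d)))) \<longrightarrow>
        asymp_le (\<lambda>n. ennreal (\<delta> n)) (log_rate (- 1 / (4 + real CARD('d)))) \<longrightarrow>
        asymp_le (\<lambda>n. sup_risk (M n) unit_cube (fh n) (f n))
                 (log_rate (- 2 / (4 + real CARD('d)))))"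
proof -
  have Y_eq: "(\<lambda>i. Y n i \<omega>) = (\<lambda>i. u n (real i * \<Delta>t n) + \<epsilon> n i \<omega>)" for n \<omega>
    using assms(12) by blast
  have fh_eq: "fh n = (\<lambda>\<omega>. nn_estimator (t\<^sub>N n) (real n * \<Delta>t n) (h n) (\<theta>\<^sub>0 n \<omega>) (\<theta>\<^sub>1 n \<omega>))" for n
    using assms(8,17) by (intro ext) simp
  have fit: "local_linear_fit K (h n) n (\<Delta>t n) (\<lambda>i. u n (real i * \<Delta>t n) + \<epsilon> n i \<omega>)
      (real n * \<Delta>t n) (\<theta>\<^sub>0 n \<omega>) (\<theta>\<^sub>1 n \<omega>)" if "\<omega> \<in> space (M n)" for n \<omega>
    using assms(15)[OF that] unfolding Y_eq assms(8) .
  have T0: "T n \<ge> 0" for n using assms(7)[of n] by (simp add: assms(8))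
  have part1: "asymp_le (\<lambda>n. sup_risk (M n) (ball_union (u n ` {0..T n}) (\<delta> n)) (fh n) (f n))
      (log_rate (- 2 / (4 + real CARD('d))))"
    if "\<And>n. \<delta> n \<ge> 0" "\<forall>\<^sub>F n in sequentially. 2 * h n \<le> T n"
      "asymp_le (\<lambda>n. ennreal (T n)) (log_rate ((real CARD('d) - 1) / (4 + real CARD('d))))"
      "asymp_le (\<lambda>n. ennreal (\<delta> n)) (log_rate (- 1 / (4 + real CARD('d))))" for \<delta>
    unfolding fh_eq assms(8)
    by (rule nn_estimator_rate[OF assms(2-7,9-11,13) assms(14)[unfolded assms(8)] fit assms(16)
        that[unfolded assms(8)]])
  define r where "r = (\<lambda>n. SUP x\<in>unit_cube. INF t\<in>{0..T n}. norm (u n t - x))"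
  have cover: "0 \<le> r n" "unit_cube \<subseteq> ball_union (u n ` {0..T n}) (r n)" for n
    unfolding r_def by (rule covering_radius_unit_cube[OF T0 flow_line_continuous[OF assms(9)]])+
  have part2: "asymp_le (\<lambda>n. sup_risk (M n) unit_cube (fh n) (f n)) (log_rate (- 2 / (4 + real CARD('d))))"
    if Tb: "asymp_le (\<lambda>n. ennreal (T n)) (log_rate ((real CARD('d) - 1) / (4 + real CARD('d))))"
      and rb: "asymp_le (\<lambda>n. ennreal (r n)) (log_rate (- 1 / (4 + real CARD('d))))"
  proof -
    define \<rho> where "\<rho> = (\<lambda>n. (real n / ln (real n)) powr (- 1 / (4 + real CARD('d))))"
    have \<rho>0: "(\<lambda>n. c * \<rho> n) \<longlonglongrightarrow> 0" for c
      using tendsto_mult_right_zero[OF ln_over_powr_tendsto_0[of "1 / (4 + real CARD('d))"], of c]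
      by (simp add: \<rho>_def)
    obtain c c' where hc: "\<forall>\<^sub>F n in sequentially. h n \<le> c * \<rho> n"
      using bandwidth_bounds[OF _ T0 assms(13,14) Tb] unfolding \<rho>_def by auto
    obtain c4 where c4: "\<forall>\<^sub>F n in sequentially. r n \<le> c4 * \<rho> n"
      using rb unfolding log_rate_def \<rho>_def by (auto elim: asymp_le_realE)
    have ev1: "\<forall>\<^sub>F n in sequentially. c4 * \<rho> n < 1 / 4"
      by (rule order_tendstoD(2)[OF \<rho>0]) simp
    \<comment> \<open>With h \<le> c * \<rho> this means that \<open>L\<^sub>0 * (2 * h n)\<close>
      stays below 1 / 2, which is the lower bound on \<open>L\<^sub>0 * T n\<close> from the
      covering.\<close>
    have ev2: "\<forall>\<^sub>F n in sequentially. 4 * L\<^sub>0 * c * \<rho> n < 1"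
      by (rule order_tendstoD(2)[OF \<rho>0]) simp
    have "\<forall>\<^sub>F n in sequentially. 2 * h n \<le> T n"
      using hc c4 ev1 ev2
    proof eventually_elim
      case (elim n)
      have "1 / 2 \<le> L\<^sub>0 * T n"
        using elim by (intro covering_time_lower_bound[OF assms(6,9) T0 cover(2)]) simp
      moreover have "L\<^sub>0 * (2 * h n) \<le> L\<^sub>0 * (2 * (c * \<rho> n))"
        using elim assms(2) by (intro mult_left_mono) auto
      ultimately have "L\<^sub>0 * (2 * h n) \<le> L\<^sub>0 * T n" using elim by simp
      then show ?case using assms(2) by simp
    qed
    \<comment> \<open>The first claim with the covering radius as \<delta> controls the risk on a
      set containing the cube; monotonicity of the risk does the rest.\<close>
    then have "asymp_le (\<lambda>n. sup_risk (M n) (ball_union (u n ` {0..T n}) (r n)) (fh n) (f n))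
        (log_rate (- 2 / (4 + real CARD('d))))"
      by (rule part1[OF cover(1) _ Tb rb])
    then obtain B where "\<forall>\<^sub>F n in sequentially. sup_risk (M n) (ball_union (u n ` {0..T n}) (r n)) (fh n) (f n)
        \<le> ennreal B * log_rate (- 2 / (4 + real CARD('d))) n"
      using asymp_leE by blast
    then have "\<forall>\<^sub>F n in sequentially. sup_risk (M n) unit_cube (fh n) (f n)
        \<le> ennreal B * log_rate (- 2 / (4 + real CARD('d))) n"
      by eventually_elim (rule order_trans[OF sup_risk_mono[OF cover(2)]])
    then show ?thesis using log_rate_eventually_proper by (rule asymp_leI)
  qed
  show ?thesis
    unfolding Let_def r_def[symmetric] using part1 part2 by blast
qed

end
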